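(* Let $(\sigma_i)_{i\in\mathbb{N}}$ be an i.i.d. sequence of copies of $\sigma_0$, and let $m_i:=\max_{j\le i}\sigma_j$ and $S_i:=\sum_{j\le i}\sigma_j$. If Assumption A holds, then almost-surely \[ \liminf_{i\to\infty}\frac{S_i}{m_i}=1 \quad\text{and}\quad \limsup_{i\to\infty}\frac{S_i}{m_i}\le N-1. \] If moreover $N<\infty$ and $\sum_{n\in\mathbb{N}}d(e^n)^{N-2}=\infty$, then almost-surely $\limsup_{i\to\infty} S_i/m_i=N-1$.
   Context: $\sigma_0$ is a strictly positive random variable under $\mathbf{P}$; $L(u):=1/\mathbf{P}(\sigma_0>u)$ is assumed slowly varying: $\lim_{u\to\infty}L(uv)/L(u)=1$ for all $v>0$. Assumption A: $L$ is continuous, and there exist functions $g,k$ with $g(u)\to0$ as $u\to\infty$, $g$ eventually monotone decreasing, such that $\lim_{u\to\infty}\big(L(uv)/L(u)-1\big)/g(u)=k(v)$ for every $v>0$, where there exists $v$ with $k(v)\neq0$ and $k(uv)\ne k(u)$ for all $u>0$. Under Assumption A, $d(u):=g(L^{-1}(u))$ with $L^{-1}$ the right-continuous inverse of $L$, and \[N:=\min\Big\{\ell\in\{2,3,\dots\}: \sum_{n\in\mathbb{N}}\big(d(e^n)\log n\big)^{\ell-1}<\infty\Big\},\] with $N=\infty$ if no such $\ell$ exists. *)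

theory Defs
  imports "HOL-Probability.Probability"
begin

definition tailL :: "'a measure \<Rightarrow> ('a \<Rightarrow> real) \<Rightarrow> real \<Rightarrow> real" where
  "tailL M X u = 1 / measure M {x \<in> space M. u < X x}"

definition rc_inv :: "(real \<Rightarrow> real) \<Rightarrow> real \<Rightarrow> real" where
  "rc_inv L y = Inf {x. y < L x}"

definition dfun :: "(real \<Rightarrow> real) \<Rightarrow> (real \<Rightarrow> real) \<Rightarrow> real \<Rightarrow> real" where
  "dfun L g u = g (rc_inv L u)"

definition N_index :: "(real \<Rightarrow> real) \<Rightarrow> enat" where
  "N_index d = (if \<exists>l::nat. 2 \<le> l \<and> summable (\<lambda>n::nat. (d (exp (real n)) * ln (real n)) ^ (l - 1))
     then enat (LEAST l::nat. 2 \<le> l \<and> summable (\<lambda>n::nat. (d (exp (real n)) * ln (real n)) ^ (l - 1)))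
     else \<infinity>)"

end

theory Submission
  imports Defs
begin

text \<open>Let \<open>U\<close> be the inverse of \<open>L\<close>, so that \<open>m\<^sub>i\<close> is of order \<open>U(i)\<close>.
  The second-order condition forces \<open>g\<close> to be slowly varying (otherwise \<open>L\<close> would be bounded), and then
  both the number of values in \<open>[\<delta>s, s]\<close> and the sum of the values below \<open>s\<close>, divided by \<open>s\<close>, have
  mean of order \<open>g(s) / L(s)\<close> per draw.

  Upper bound: \<open>m\<^sub>i\<close> passes through \<open>(U(e\<^sup>n), U(e\<^sup>n\<^sup>+\<^sup>1)]\<close> before time \<open>2 e\<^sup>n\<^sup>+\<^sup>1 log n\<close>. Within this window
  there are about \<open>log (L(U(e\<^sup>n\<^sup>+\<^sup>1)) / L(U(e\<^sup>n))) = 1\<close> records, and the probability that a record \<open>s\<close> is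
  accompanied by \<open>N - 1\<close> further units of mass, measured by \<open>min 1 (\<sigma>\<^sub>l / (\<delta> s))\<close>, is at most a constant times
  \<open>(d(e\<^sup>n) log n)\<^sup>N\<^sup>-\<^sup>1\<close>, which is summable. Counting only records, rather than all values in the window,
  is what avoids an additional factor \<open>log n\<close>.

  Lower bound: in the disjoint time blocks \<open>[\<eta> e\<^sup>n, \<eta> e\<^sup>n\<^sup>+\<^sup>1)\<close>, the \<open>N - 1\<close> largest values lie within a
  factor \<open>c\<close> of each other with probability at least a constant times \<open>d(e\<^sup>n\<^sup>+\<^sup>1)\<^sup>N\<^sup>-\<^sup>2\<close>, and all earlier values
  stay below \<open>U(e\<^sup>n)\<close> with probability at least \<open>1 - \<eta>\<close>.\<close>

section \<open>Slow variation with remainder\<close>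

text \<open>The deterministic part of the argument, with \<open>L\<close> as the reciprocal tail:
  \<open>L 0 = 1\<close> reflects strict positivity of the variable and \<open>L_top\<close> its
  finiteness.\<close>

locale second_order_slow =
  fixes L g k :: "real \<Rightarrow> real"
  assumes mono_L: "mono L"
    and L_zero: "L 0 = 1"
    and L_top: "filterlim L at_top at_top"
    and L_cont: "continuous_on UNIV L"
    and L_slow: "\<And>v. 0 < v \<Longrightarrow> ((\<lambda>u. L (u * v) / L u) \<longlongrightarrow> 1) at_top"
    and g_lim: "(g \<longlongrightarrow> 0) at_top"
    and g_mono: "\<exists>u0. \<forall>x y. u0 \<le> x \<longrightarrow> x \<le> y \<longrightarrow> g y \<le> g x"
    and k_lim: "\<And>v. 0 < v \<Longrightarrow> ((\<lambda>u. (L (u * v) / L u - 1) / g u) \<longlongrightarrow> k v) at_top"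
    and k_nonzero: "\<exists>v>0. k v \<noteq> 0"
begin

abbreviation U :: "real \<Rightarrow> real" where
  "U \<equiv> rc_inv L"

lemma L_mono: "x \<le> y \<Longrightarrow> L x \<le> L y"
  using mono_L by (rule monoD)

lemma L_ge_1: "0 \<le> x \<Longrightarrow> 1 \<le> L x"
  using L_mono[of 0 x] L_zero by simp

lemma L_pos: "0 \<le> x \<Longrightarrow> 0 < L x"
  using L_ge_1[of x] by linarith

text \<open>Continuity prevents \<open>L\<close> from jumping over \<open>y\<close>: it is at least
  \<open>y\<close> to the right of the infimum and at most \<open>y\<close> to the left, and both
  one-sided limits equal the value there.\<close>

lemma L_rc_inv:
  assumes "1 \<le> y"
  shows "L (U y) = y"
proof -
  let ?A = "{x. y < L x}"
  have ne: "?A \<noteq> {}"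
    using filterlim_at_top_dense[THEN iffD1, OF L_top] eventually_happens'[of "at_top :: real filter"]
    by (metis (mono_tags, lifting) empty_iff mem_Collect_eq trivial_limit_at_top_linorder)
  have nonneg: "0 \<le> x" if "x \<in> ?A" for x
    using L_mono[of x 0] that assms L_zero by (cases "0 \<le> x") auto
  then have bdd: "bdd_below ?A"
    by (meson bdd_below.I)
  have cont: "isCont L (U y)"
    using L_cont by (simp add: continuous_on_eq_continuous_at)
  have "y \<le> L (U y)"
  proof (rule tendsto_lowerbound)
    show "(L \<longlongrightarrow> L (U y)) (at_right (U y))"
      using cont by (simp add: isCont_def filterlim_at_split)
    have "y \<le> L x" if x: "U y < x" for x
    proof -
      obtain z where "z \<in> ?A" "z < x"
        using cInf_lessD[OF ne, of x] x by (auto simp: rc_inv_def)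
      then show ?thesis
        using L_mono[of z x] by auto
    qed
    then show "\<forall>\<^sub>F x in at_right (U y). y \<le> L x"
      by (auto simp: eventually_at_filter)
  qed simp
  moreover have "L (U y) \<le> y"
  proof (rule tendsto_upperbound)
    show "(L \<longlongrightarrow> L (U y)) (at_left (U y))"
      using cont by (simp add: isCont_def filterlim_at_split)
    have "L x \<le> y" if "x < U y" for x
      using that cInf_lower[OF _ bdd, of x] unfolding rc_inv_def by (meson leD leI mem_Collect_eq)
    then show "\<forall>\<^sub>F x in at_left (U y). L x \<le> y"
      by (auto simp: eventually_at_filter)
  qed simp
  ultimately show ?thesis by simp
qed

lemma rc_inv_gt: "1 \<le> y \<Longrightarrow> L x < y \<Longrightarrow> x < U y"
  using L_rc_inv[of y] L_mono[of "U y" x] by fastforce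

lemma rc_inv_mono: "1 \<le> y \<Longrightarrow> y \<le> z \<Longrightarrow> U y \<le> U z"
  using rc_inv_gt[of z "U y"] L_rc_inv[of y] by (cases "y = z") auto

lemma rc_inv_at_top: "filterlim U at_top at_top"
  unfolding filterlim_at_top_dense
proof
  fix Z :: real
  show "\<forall>\<^sub>F y in at_top. Z < U y"
    using eventually_gt_at_top[of "max 1 (L Z)"]
    by eventually_elim (auto intro: rc_inv_gt)
qed

text \<open>A function decreasing to 0 is nonnegative, and one zero would make it vanish from there
  on. Division by zero yields 0, so every quotient in \<open>k_lim\<close> would then tend to 0,
  against \<open>k_nonzero\<close>.\<close>

lemma g_pos: "\<forall>\<^sub>F x in at_top. 0 < g x"
proof -
  obtain u0 where u0: "\<And>x y. u0 \<le> x \<Longrightarrow> x \<le> y \<Longrightarrow> g y \<le> g x"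
    using g_mono by blast
  have nonneg: "0 \<le> g x" if "u0 \<le> x" for x
  proof (rule tendsto_upperbound[OF g_lim])
    show "\<forall>\<^sub>F i in at_top. g i \<le> g x"
      using eventually_ge_at_top[of x] by eventually_elim (use u0 that in auto)
  qed simp
  have "g x \<noteq> 0" if x: "u0 \<le> x" for x
  proof
    assume "g x = 0"
    then have z: "g y = 0" if "x \<le> y" for y
      using u0[OF x that] nonneg[of y] that x by simp
    obtain v where v: "0 < v" "k v \<noteq> 0" using k_nonzero by blast
    have "((\<lambda>u. (L (u * v) / L u - 1) / g u) \<longlongrightarrow> 0) at_top"
      by (rule tendsto_eventually) (use eventually_ge_at_top[of x] in eventually_elim, simp add: z)
    then have "k v = 0"
      using k_lim[OF v(1)] tendsto_unique[OF trivial_limit_at_top_linorder] by blast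
    with v show False by simp
  qed
  then show ?thesis
    using nonneg eventually_ge_at_top[of u0] by (metis (no_types, lifting) eventually_mono less_le)
qed

lemma g_decreasing:
  obtains u0 where "0 < u0" "\<And>x. u0 \<le> x \<Longrightarrow> 0 < g x"
    "\<And>x y. u0 \<le> x \<Longrightarrow> x \<le> y \<Longrightarrow> g y \<le> g x"
proof -
  obtain u0 where u0: "\<And>x y. u0 \<le> x \<Longrightarrow> x \<le> y \<Longrightarrow> g y \<le> g x"
    using g_mono by blast
  obtain u1 where u1: "\<And>x. u1 \<le> x \<Longrightarrow> 0 < g x"
    using g_pos by (auto simp: eventually_at_top_linorder)
  show thesis
    by (rule that[of "max 1 (max u0 u1)"]) (use u0 u1 in auto)
qed

text \<open>If \<^term>\<open>\<psi> < 1\<close>, then \<^term>\<open>g\<close> decays geometrically along \<open>c\<^sup>r x\<close>, so the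
  product of the ratios \<open>L (c\<^sup>r\<^sup>+\<^sup>1 x) / L (c\<^sup>r x)\<close> converges, contradicting \<open>L \<rightarrow> \<infinity>\<close>.\<close>
lemma g_ratio_limit_ge_1:
  assumes c: "1 < c" and lim: "((\<lambda>x. g (c * x) / g x) \<longlongrightarrow> \<psi>) at_top"
  shows "1 \<le> \<psi>"
proof (rule ccontr)
  assume "\<not> 1 \<le> \<psi>"
  \<comment> \<open>A rate strictly between \<psi> and 1; the lower bound \<open>1/2\<close> keeps
    it positive even if \<psi> is not.\<close>
  define \<rho> where "\<rho> = max (1/2) ((\<psi> + 1) / 2)"
  have \<rho>: "\<psi> < \<rho>" "0 < \<rho>" "\<rho> < 1"
    using \<open>\<not> 1 \<le> \<psi>\<close> by (auto simp: \<rho>_def max_def)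
  define C where "C = \<bar>k c\<bar> + 1"
  have C: "0 < C" "k c < C" by (auto simp: C_def)
  obtain u0 where u0: "0 < u0" "\<And>x. u0 \<le> x \<Longrightarrow> 0 < g x"
    using g_decreasing by metis
  have "\<forall>\<^sub>F x in at_top. g (c * x) / g x < \<rho>"
    using lim \<rho> by (simp add: order_tendsto_iff)
  moreover have "\<forall>\<^sub>F x in at_top. (L (x * c) / L x - 1) / g x < C"
    using k_lim[of c] c C by (simp add: order_tendsto_iff)
  ultimately have "\<forall>\<^sub>F x in at_top. g (c * x) / g x < \<rho> \<and> (L (x * c) / L x - 1) / g x < C"
    by eventually_elim auto
  then obtain u1 where u1: "\<And>x. u1 \<le> x \<Longrightarrow> g (c * x) / g x < \<rho>"
    "\<And>x. u1 \<le> x \<Longrightarrow> (L (x * c) / L x - 1) / g x < C"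
    by (auto simp: eventually_at_top_linorder)
  define x where "x r = c ^ r * max u0 u1" for r :: nat
  have x0: "0 < max u0 u1" using u0 by auto
  have x_ge: "max u0 u1 \<le> x r" for r
    using mult_right_mono[of 1 "c ^ r" "max u0 u1"] x0 c by (simp add: x_def)
  have x_Suc: "x (Suc r) = c * x r" for r by (simp add: x_def)
  have gx: "0 < g (x r)" for r using u0(2) x_ge[of r] by simp
  have g_geo: "g (x r) \<le> \<rho> ^ r * g (x 0)" for r
  proof (induction r)
    case (Suc r)
    have "g (x (Suc r)) \<le> \<rho> * g (x r)"
      using u1(1)[of "x r"] x_ge[of r] gx[of r] by (simp add: x_Suc field_simps)
    also have "\<dots> \<le> \<rho> * (\<rho> ^ r * g (x 0))"
      using Suc \<rho> by (intro mult_left_mono) auto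
    finally show ?case by simp
  qed simp
  have x_pos: "0 < x r" for r using x_ge[of r] x0 by linarith
  have L_step: "L (x (Suc r)) \<le> L (x r) * exp (C * g (x 0) * \<rho> ^ r)" for r
  proof -
    have "L (c * x r) / L (x r) - 1 < C * g (x r)"
      using u1(2)[of "x r"] x_ge[of r] gx[of r] by (simp add: field_simps)
    then have "L (c * x r) / L (x r) \<le> 1 + C * g (x r)" by simp
    also have "\<dots> \<le> 1 + C * (\<rho> ^ r * g (x 0))"
      using g_geo[of r] C by simp
    also have "\<dots> \<le> exp (C * g (x 0) * \<rho> ^ r)"
      using exp_ge_add_one_self[of "C * g (x 0) * \<rho> ^ r"] by (simp add: mult_ac)
    finally show ?thesis
      using L_pos[of "x r"] x_pos[of r] by (simp add: x_Suc field_simps)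
  qed
  have L_bd: "L (x r) \<le> L (x 0) * exp (C * g (x 0) * (\<Sum>i<r. \<rho> ^ i))" for r
  proof (induction r)
    case (Suc r)
    have "L (x (Suc r)) \<le> L (x 0) * exp (C * g (x 0) * (\<Sum>i<r. \<rho> ^ i)) * exp (C * g (x 0) * \<rho> ^ r)"
      using L_step[of r] Suc by (meson exp_ge_zero mult_right_mono order_trans)
    then show ?case by (simp add: exp_add distrib_left mult_ac)
  qed simp
  have sum_bd: "(\<Sum>i<r. \<rho> ^ i) \<le> 1 / (1 - \<rho>)" for r
    using \<rho> sum_le_suminf[of "\<lambda>i. \<rho> ^ i" "{..<r}"] suminf_geometric[of \<rho>] summable_geometric[of \<rho>] by simp
  have bounded: "L (x r) \<le> L (x 0) * exp (C * g (x 0) * (1 / (1 - \<rho>)))" for r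
  proof -
    have "L (x 0) * exp (C * g (x 0) * (\<Sum>i<r. \<rho> ^ i)) \<le> L (x 0) * exp (C * g (x 0) * (1 / (1 - \<rho>)))"
      using sum_bd[of r] C gx[of 0] L_pos[of "x 0"] x_pos[of 0]
      by (intro mult_left_mono iffD2[OF exp_le_cancel_iff]) auto
    then show ?thesis using L_bd[of r] by linarith
  qed
  have "filterlim (\<lambda>r. x r) at_top sequentially"
    unfolding x_def using x0 c
    by (intro filterlim_at_top_mult_tendsto_pos[OF tendsto_const] filterlim_at_infinity_imp_filterlim_at_top
      filterlim_realpow_sequentially_gt1) auto
  then have "filterlim (\<lambda>r. L (x r)) at_top sequentially"
    by (rule filterlim_compose[OF L_top])
  then have "\<forall>\<^sub>F r in sequentially. L (x 0) * exp (C * g (x 0) * (1 / (1 - \<rho>))) < L (x r)"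
    by (simp add: filterlim_at_top_dense)
  then show False
    using bounded by (meson eventually_happens' leD sequentially_bot)
qed

text \<open>Splitting the increment of \<open>L\<close> from \<open>x\<close> to
  \<open>x * c * v\<close> at \<open>x * c\<close> writes \<open>k (c * v) - k c\<close> as the
  limit of \<open>g (c * x) / g x\<close> times a factor tending to \<open>k v\<close>. A point
  where \<open>k\<close> is nonzero shows that the ratio converges. The limit is at most 1 by
  monotonicity of \<open>g\<close> and at least 1 by the preceding lemma; additivity of
  \<open>k\<close> follows.\<close>

lemma g_ratio:
  assumes "1 < c"
  shows "((\<lambda>x. g (c * x) / g x) \<longlongrightarrow> 1) at_top"
    and "0 < v \<Longrightarrow> k (c * v) = k c + k v"
proof -
  have cx: "filterlim (\<lambda>x. x * c) at_top at_top"
    using assms by (intro filterlim_at_top_mult_tendsto_pos[OF tendsto_const] filterlim_ident) auto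
  obtain u0 where u0: "0 < u0" "\<And>x. u0 \<le> x \<Longrightarrow> 0 < g x"
    "\<And>x y. u0 \<le> x \<Longrightarrow> x \<le> y \<Longrightarrow> g y \<le> g x"
    using g_decreasing by metis
  have idl: "((\<lambda>x. (g (c * x) / g x) * ((L (x * c * v) / L (x * c) - 1) / g (x * c) * (L (x * c) / L x)))
      \<longlongrightarrow> k (c * v) - k c) at_top" if v: "0 < v" for v
  proof (rule Lim_transform_eventually)
    show "((\<lambda>x. (L (x * (c * v)) / L x - 1) / g x - (L (x * c) / L x - 1) / g x)
        \<longlongrightarrow> k (c * v) - k c) at_top"
      using assms v by (intro tendsto_diff k_lim) auto
    show "\<forall>\<^sub>F x in at_top. (L (x * (c * v)) / L x - 1) / g x - (L (x * c) / L x - 1) / g x =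
      (g (c * x) / g x) * ((L (x * c * v) / L (x * c) - 1) / g (x * c) * (L (x * c) / L x))"
      using eventually_ge_at_top[of u0]
    proof eventually_elim
      case (elim x)
      have "0 < g x" "0 < g (x * c)" "0 < L x" "0 < L (x * c)"
        using elim u0(1) assms u0(2)[of x] u0(2)[OF order_trans[OF elim mult_left_mono[of 1 c x, simplified]]]
        by (auto intro!: L_pos)
      then show ?case by (simp add: field_simps)
    qed
  qed
  have lim2: "((\<lambda>x. (L (x * c * v) / L (x * c) - 1) / g (x * c) * (L (x * c) / L x)) \<longlongrightarrow> k v) at_top"
    if v: "0 < v" for v
    using tendsto_mult[OF filterlim_compose[OF k_lim[OF v] cx] L_slow[of c]] assms by simp
  obtain w where w: "0 < w" "k w \<noteq> 0" using k_nonzero by blast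
  have lim3: "((\<lambda>x. g (c * x) / g x) \<longlongrightarrow> (k (c * w) - k c) / k w) at_top"
  proof (rule Lim_transform_eventually)
    show "((\<lambda>x. (g (c * x) / g x) * ((L (x * c * w) / L (x * c) - 1) / g (x * c) * (L (x * c) / L x))
       / ((L (x * c * w) / L (x * c) - 1) / g (x * c) * (L (x * c) / L x)))
      \<longlongrightarrow> (k (c * w) - k c) / k w) at_top"
      using w by (intro tendsto_divide idl lim2) auto
    have "\<forall>\<^sub>F x in at_top. (L (x * c * w) / L (x * c) - 1) / g (x * c) * (L (x * c) / L x) \<noteq> 0"
      using lim2[OF w(1)] w(2) by (rule tendsto_imp_eventually_ne)
    then show "\<forall>\<^sub>F x in at_top. (g (c * x) / g x) * ((L (x * c * w) / L (x * c) - 1) / g (x * c) * (L (x * c) / L x))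
       / ((L (x * c * w) / L (x * c) - 1) / g (x * c) * (L (x * c) / L x)) = g (c * x) / g x"
      by eventually_elim auto
  qed
  have "(k (c * w) - k c) / k w \<le> 1"
  proof (rule tendsto_upperbound[OF lim3])
    show "\<forall>\<^sub>F x in at_top. g (c * x) / g x \<le> 1"
      using eventually_ge_at_top[of u0]
    proof eventually_elim
      case (elim x)
      then show ?case
        using u0 assms mult_right_mono[of 1 c x] by simp
    qed
  qed simp
  with g_ratio_limit_ge_1[OF assms lim3] lim3 show lim: "((\<lambda>x. g (c * x) / g x) \<longlongrightarrow> 1) at_top"
    by simp
  show "k (c * v) = k c + k v" if "0 < v"
    using tendsto_unique[OF trivial_limit_at_top_linorder idl[OF that]
        tendsto_mult[OF lim lim2[OF that]]] by simp
qed

lemma k_mono: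
  assumes "0 < v" "v \<le> w"
  shows "k v \<le> k w"
proof (rule tendsto_le[OF trivial_limit_at_top_linorder k_lim k_lim])
  obtain u0 where u0: "0 < u0" "\<And>x. u0 \<le> x \<Longrightarrow> 0 < g x"
    using g_decreasing by metis
  show "\<forall>\<^sub>F u in at_top. (L (u * v) / L u - 1) / g u \<le> (L (u * w) / L u - 1) / g u"
    using eventually_ge_at_top[of u0]
  proof eventually_elim
    case (elim u)
    then show ?case
      using assms u0 L_pos[of u]
      by (intro divide_right_mono diff_right_mono L_mono mult_left_mono) (auto simp: less_imp_le)
  qed
qed (use assms in auto)

lemma k_one: "k 1 = 0"
  using g_ratio(2)[of 2 1] by simp

text \<open>If \<open>k c = 0\<close>, additivity gives zeros at all powers of \<open>c\<close>,
  monotonicity squeezes \<open>k\<close> to 0 on all arguments above 1, and additivity with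
  \<open>1 / w\<close> extends this to all positive arguments, against
  \<open>k_nonzero\<close>.\<close>

lemma k_pos:
  assumes "1 < c"
  shows "0 < k c"
proof (rule ccontr)
  assume "\<not> 0 < k c"
  then have kc: "k c = 0"
    using k_mono[of 1 c] k_one assms by simp
  have kcm: "k (c ^ m) = 0" for m
  proof (induction m)
    case (Suc m)
    then show ?case
      using g_ratio(2)[OF assms, of "c ^ m"] assms kc by simp
  qed (simp add: k_one)
  have k0: "k w = 0" if "1 \<le> w" for w
  proof -
    obtain m where "w < c ^ m" using real_arch_pow[OF assms] by blast
    then show ?thesis
      using k_mono[of 1 w] k_mono[of w "c ^ m"] that k_one kcm by simp
  qed
  have "k w = 0" if "0 < w" for w
  proof (cases "1 \<le> w")
    case False
    then show ?thesis
      using g_ratio(2)[of "1 / w" w] that k0[of "1 / w"] k_one by simp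
  qed (use k0 in simp)
  with k_nonzero show False by blast
qed

text \<open>Since \<^term>\<open>L\<close> and \<^term>\<open>g\<close> are slowly varying, \<open>s g(s) / L(s)\<close> grows by a factor
  of at least \<open>3/2\<close> when \<open>s\<close> is doubled, so the increments of \<^term>\<open>e\<close> sum up geometrically.\<close>
lemma truncated_mean_bound:
  assumes e_step: "\<And>x. 0 < x \<Longrightarrow> e (2 * x) \<le> e x + 2 * x * (1 / L x - 1 / L (2 * x))"
    and e_le: "\<And>x. 0 < x \<Longrightarrow> e x \<le> x"
  obtains K s0 where "0 < K" "0 < s0" "\<And>s. s0 \<le> s \<Longrightarrow> e s \<le> K * s * g s / L s"
proof -
  define a where "a x = x * g x / L x" for x
  obtain u0 where u0: "0 < u0" "\<And>x. u0 \<le> x \<Longrightarrow> 0 < g x"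
    "\<And>x y. u0 \<le> x \<Longrightarrow> x \<le> y \<Longrightarrow> g y \<le> g x"
    using g_decreasing by metis
  define C where "C = 2 * (k 2 + 1)"
  have k2: "0 < k 2" by (rule k_pos) simp
  \<comment> \<open>The thresholds are chosen so that \<open>2 * (8/9) * (27/32) = 3/2\<close>, the
    growth factor claimed in \<open>a_step\<close>.\<close>
  have "\<forall>\<^sub>F x in at_top. 8/9 < g (2 * x) / g x"
    by (rule order_tendstoD(1)[OF g_ratio(1)]) auto
  moreover have "\<forall>\<^sub>F x in at_top. L (x * 2) / L x < 32/27"
    by (rule order_tendstoD(2)[OF L_slow]) auto
  moreover have "\<forall>\<^sub>F x in at_top. (L (x * 2) / L x - 1) / g x < k 2 + 1"
    using k_lim[of 2] by (simp add: order_tendsto_iff)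
  ultimately have "\<forall>\<^sub>F x in at_top. 8/9 < g (2 * x) / g x \<and> L (x * 2) / L x < 32/27
      \<and> (L (x * 2) / L x - 1) / g x < k 2 + 1"
    by eventually_elim auto
  then obtain u1 where u1: "\<And>x. u1 \<le> x \<Longrightarrow> 8/9 < g (2 * x) / g x"
    "\<And>x. u1 \<le> x \<Longrightarrow> L (x * 2) / L x < 32/27"
    "\<And>x. u1 \<le> x \<Longrightarrow> (L (x * 2) / L x - 1) / g x < k 2 + 1"
    by (auto simp: eventually_at_top_linorder)
  define x0 where "x0 = max u0 u1"
  have x0: "0 < x0" "u0 \<le> x0" "u1 \<le> x0" using u0 by (auto simp: x0_def)
  have a_pos: "0 < a x" if "x0 \<le> x" for x
    using that x0 u0(2)[of x] L_pos[of x] by (simp add: a_def)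
  have a_step: "3/2 * a x \<le> a (2 * x)" if x: "x0 \<le> x" for x
  proof -
    have p: "0 < g x" "0 < L x" "0 < L (2 * x)" "0 < x"
      using x x0 u0(2)[of x] by (auto intro!: L_pos)
    have "8/9 * g x \<le> g (2 * x)"
      using u1(1)[of x] x x0 p by (simp add: field_simps)
    moreover have "27/32 / L x \<le> 1 / L (2 * x)"
      using u1(2)[of x] x x0 p by (simp add: field_simps)
    ultimately have "(8/9 * g x) * (27/32 / L x) \<le> g (2 * x) * (1 / L (2 * x))"
      using p u0(2)[of "2 * x"] x x0 by (intro mult_mono) auto
    then have "2 * x * ((8/9 * g x) * (27/32 / L x)) \<le> 2 * x * (g (2 * x) * (1 / L (2 * x)))"
      using p by (intro mult_left_mono) auto
    then show ?thesis by (simp add: a_def)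
  qed
  have step: "e (2 * x) \<le> e x + C * a (2 * x)" if x: "x0 \<le> x" for x
  proof -
    have p: "0 < g x" "0 < L x" "0 < L (2 * x)" "0 < x"
      using x x0 u0(2)[of x] by (auto intro!: L_pos)
    have "8/9 * g x \<le> g (2 * x)"
      using u1(1)[of x] x x0 p by (simp add: field_simps)
    then have g2: "g x \<le> 2 * g (2 * x)" using p by simp
    have "L (2 * x) / L x - 1 \<le> (k 2 + 1) * g x"
      using u1(3)[of x] x x0 p by (simp add: field_simps)
    also have "\<dots> \<le> (k 2 + 1) * (2 * g (2 * x))"
      using g2 k2 by (intro mult_left_mono) auto
    finally have "L (2 * x) / L x - 1 \<le> C * g (2 * x)" by (simp add: C_def algebra_simps)
    then have "2 * x * ((L (2 * x) / L x - 1) / L (2 * x)) \<le> 2 * x * (C * g (2 * x) / L (2 * x))"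
      using p by (intro mult_left_mono divide_right_mono) auto
    also have "2 * x * ((L (2 * x) / L x - 1) / L (2 * x)) = 2 * x * (1 / L x - 1 / L (2 * x))"
      using p by (simp add: field_simps)
    finally show ?thesis
      using e_step[of x] p by (simp add: a_def mult_ac)
  qed
  \<comment> \<open>With \<open>C \<le> K / 3\<close> the inductive step closes as
    \<open>2/3 * K + K / 3 = K\<close>. The second entry covers the initial interval from
    \<open>x0\<close> to \<open>2 * x0\<close>, where only \<open>e s \<le> s\<close> is
    available.\<close>
  define K where "K = max (3 * C) (2 * L (2 * x0) / g (2 * x0))"
  have K: "3 * C \<le> K" "2 * L (2 * x0) / g (2 * x0) \<le> K" by (auto simp: K_def)
  have C: "0 < C" using k2 by (simp add: C_def)
  have bd: "e s \<le> K * a s" if "x0 \<le> s" "s \<le> x0 * 2 ^ Suc r" for s r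
    using that
  proof (induction r arbitrary: s)
    case 0
    have p: "0 < g (2 * x0)" "0 < L (2 * x0)" "0 < L s" "0 < s"
      using 0 x0 u0(2)[of "2 * x0"] by (auto intro!: L_pos)
    have "2 * L (2 * x0) / g (2 * x0) * (x0 * g (2 * x0) / L (2 * x0)) \<le> K * a s"
      unfolding a_def using p K C 0 x0 u0(3)[of s "2 * x0"]
      by (intro mult_mono frac_le L_mono) auto
    moreover have "e s \<le> 2 * x0" using e_le[of s] 0 x0 by simp
    ultimately show ?case using p by simp
  next
    case (Suc r)
    show ?case
    proof (cases "s \<le> x0 * 2 ^ Suc r")
      case True
      then show ?thesis using Suc by simp
    next
      case False
      define t where "t = s / 2"
      have "x0 * 1 \<le> x0 * 2 ^ r" using x0 by (intro mult_left_mono) auto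
      then have t: "s = 2 * t" "x0 \<le> t" "t \<le> x0 * 2 ^ Suc r"
        using False Suc.prems by (auto simp: t_def)
      have "e s \<le> K * a t + C * a s"
        using step[OF t(2)] Suc.IH[OF t(2,3)] t(1) by simp
      also have "K * a t \<le> K * (2/3 * a s)"
        using a_step[OF t(2)] t(1) K C by (intro mult_left_mono) auto
      also have "C * a s \<le> K / 3 * a s"
        using K a_pos[of s] Suc.prems by (intro mult_right_mono) auto
      finally show ?thesis by simp
    qed
  qed
  show thesis
  proof (rule that[of K x0])
    fix s assume s: "x0 \<le> s"
    obtain r where r: "s / x0 < 2 ^ r"
      using real_arch_pow[of 2 "s / x0"] by auto
    then have "s \<le> x0 * 2 ^ r"
      using x0 by (simp add: field_simps)
    also have "\<dots> \<le> x0 * 2 ^ Suc r"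
      using x0 by (intro mult_left_mono power_increasing) auto
    finally have "s \<le> x0 * 2 ^ Suc r" .
    then show "e s \<le> K * s * g s / L s"
      using bd[OF s, of r] by (simp add: a_def mult_ac)
  qed (use K C x0 in auto)
qed

end

section \<open>Clusters around a record\<close>

locale iid_sequence = prob_space M for M :: "'a measure" +
  fixes X :: "nat \<Rightarrow> 'a \<Rightarrow> real"
  assumes rv [measurable]: "\<And>i. X i \<in> borel_measurable M"
    and indep: "indep_vars (\<lambda>_. borel) X UNIV"
    and ident: "\<And>i. distr M borel (X i) = distr M borel (X 0)"
    and pos: "AE x in M. 0 < X 0 x"
begin

section \<open>Law of a single draw and products over independent draws\<close>

abbreviation L :: "real \<Rightarrow> real" where
  "L \<equiv> tailL M (X 0)"

lemma expectation_ident: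
  fixes f :: "real \<Rightarrow> real"
  assumes [measurable]: "f \<in> borel_measurable borel"
  shows "expectation (\<lambda>x. f (X i x)) = expectation (\<lambda>x. f (X 0 x))"
proof -
  have "expectation (\<lambda>x. f (X i x)) = (\<integral>y. f y \<partial>distr M borel (X i))"
    by (subst integral_distr) auto
  also have "\<dots> = (\<integral>y. f y \<partial>distr M borel (X 0))"
    by (simp add: ident[of i])
  also have "\<dots> = expectation (\<lambda>x. f (X 0 x))"
    by (subst integral_distr) auto
  finally show ?thesis .
qed

lemma prob_ident:
  assumes "A \<in> sets borel"
  shows "prob {x \<in> space M. X i x \<in> A} = prob {x \<in> space M. X 0 x \<in> A}"
proof -
  have "prob {x \<in> space M. X i x \<in> A} = measure (distr M borel (X i)) A" for i
    using assms by (subst measure_distr) (auto intro!: arg_cong[where f = prob])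
  then show ?thesis by (simp add: ident[of i])
qed

lemma expectation_prod:
  fixes f :: "nat \<Rightarrow> real \<Rightarrow> real"
  assumes I: "finite I" and f [measurable]: "\<And>i. f i \<in> borel_measurable borel"
    and bd: "\<And>i y. i \<in> I \<Longrightarrow> \<bar>f i y\<bar> \<le> C"
  shows "expectation (\<lambda>x. \<Prod>i\<in>I. f i (X i x)) = (\<Prod>i\<in>I. expectation (\<lambda>x. f i (X 0 x)))"
    and "integrable M (\<lambda>x. \<Prod>i\<in>I. f i (X i x))"
proof -
  have ind: "indep_vars (\<lambda>_. borel) (\<lambda>i x. f i (X i x)) I"
    by (rule indep_vars_compose2[OF indep_vars_subset[OF indep subset_UNIV]]) simp
  have int: "integrable M (\<lambda>x. f i (X i x))" if "i \<in> I" for i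
    by (rule integrable_const_bound[where B = C]) (use bd[OF that] in auto)
  show "expectation (\<lambda>x. \<Prod>i\<in>I. f i (X i x)) = (\<Prod>i\<in>I. expectation (\<lambda>x. f i (X 0 x)))"
    using indep_vars_lebesgue_integral[OF I ind int]
    by (simp, intro prod.cong refl expectation_ident f)
  show "integrable M (\<lambda>x. \<Prod>i\<in>I. f i (X i x))"
    by (rule indep_vars_integrable[OF I ind int])
qed

lemma prob_Ball:
  assumes I: "finite I" and A [measurable]: "\<And>i. A i \<in> sets borel"
  shows "prob {x \<in> space M. \<forall>i\<in>I. X i x \<in> A i} = (\<Prod>i\<in>I. prob {x \<in> space M. X 0 x \<in> A i})"
proof -
  have "prob {x \<in> space M. \<forall>i\<in>I. X i x \<in> A i}
      = expectation (indicator {x \<in> space M. \<forall>i\<in>I. X i x \<in> A i})"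
    using I by simp
  also have "\<dots> = expectation (\<lambda>x. \<Prod>i\<in>I. indicator (A i) (X i x))"
    using I by (intro Bochner_Integration.integral_cong) (auto simp: indicator_def)
  also have "\<dots> = (\<Prod>i\<in>I. expectation (\<lambda>x. indicator (A i) (X 0 x)))"
    by (rule expectation_prod(1)[where C = 1]) (use I in \<open>auto simp: indicator_def\<close>)
  also have "\<dots> = (\<Prod>i\<in>I. prob {x \<in> space M. X 0 x \<in> A i})"
  proof (rule prod.cong)
    fix i
    have "expectation (\<lambda>x. indicat_real (A i) (X 0 x)) = expectation (indicator {x \<in> space M. X 0 x \<in> A i})"
      by (intro Bochner_Integration.integral_cong) (auto simp: indicator_def)
    then show "expectation (\<lambda>x. indicator (A i) (X 0 x)) = prob {x \<in> space M. X 0 x \<in> A i}"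
      by simp
  qed simp
  finally show ?thesis .
qed

text \<open>With \<open>1 / 0 = 0\<close>, the double reciprocal returns the tail even where it
  vanishes.\<close>

lemma prob_gt: "prob {x \<in> space M. u < X 0 x} = 1 / L u"
  by (simp add: tailL_def)

lemma prob_le: "prob {x \<in> space M. X 0 x \<le> u} = 1 - 1 / L u"
proof -
  have "prob {x \<in> space M. X 0 x \<le> u} = 1 - prob {x \<in> space M. \<not> X 0 x \<le> u}"
    by (subst prob_neg) auto
  then show ?thesis using prob_gt[of u] by (simp add: not_le)
qed

lemma prob_interval:
  assumes "a \<le> b"
  shows "prob {x \<in> space M. X 0 x \<in> {a<..b}} = 1 / L a - 1 / L b"
proof -
  let ?A = "{x \<in> space M. a < X 0 x}" and ?B = "{x \<in> space M. b < X 0 x}"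
  have "{x \<in> space M. X 0 x \<in> {a<..b}} = ?A - ?B"
    using assms by auto
  moreover have "prob (?A - ?B) = prob ?A - prob ?B"
    using assms by (intro finite_measure_Diff) auto
  ultimately show ?thesis
    by (simp only: prob_gt)
qed

lemma AE_pos: "AE x in M. \<forall>i. 0 < X i x"
  unfolding AE_all_countable
proof
  fix i
  have "AE y in distr M borel (X 0). 0 < y"
    using pos by (subst AE_distr_iff) auto
  then have "AE y in distr M borel (X i). 0 < y" unfolding ident[of i] .
  then show "AE x in M. 0 < X i x"
    by (subst (asm) AE_distr_iff) auto
qed

lemma prob_max_le:
  assumes "finite I"
  shows "prob {x \<in> space M. \<forall>i\<in>I. X i x \<le> u} = (1 - 1 / L u) ^ card I"
proof -
  have "prob {x \<in> space M. \<forall>i\<in>I. X i x \<in> {..u}} = (\<Prod>i\<in>I. prob {x \<in> space M. X 0 x \<in> {..u}})"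
    by (rule prob_Ball[OF assms]) simp
  then show ?thesis unfolding atMost_iff prob_le by simp
qed

text \<open>The clause \<open>0 < X 0 x\<close> bounds the integrand pointwise, whereas positivity
  of \<open>X 0\<close> holds only almost surely.\<close>

definition trunc_mean :: "real \<Rightarrow> real" where
  "trunc_mean s = expectation (\<lambda>x. if 0 < X 0 x \<and> X 0 x \<le> s then X 0 x else 0)"

lemma trunc_mean_integrable: "integrable M (\<lambda>x. if 0 < X 0 x \<and> X 0 x \<le> s then X 0 x else 0)"
  by (rule integrable_const_bound[where B = "\<bar>s\<bar>"]) auto

lemma trunc_mean_le:
  assumes "0 < s"
  shows "trunc_mean s \<le> s"
proof -
  have "trunc_mean s \<le> expectation (\<lambda>_. s)"
    unfolding trunc_mean_def by (intro integral_mono trunc_mean_integrable) (use assms in auto)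
  then show ?thesis by (simp add: prob_space)
qed

lemma trunc_mean_nonneg: "0 \<le> trunc_mean s"
  unfolding trunc_mean_def by (intro integral_nonneg_AE) auto

text \<open>Each value in the layer above \<open>s\<close> contributes at most \<open>2 * s\<close>.
  This is the growth hypothesis of \<open>truncated_mean_bound\<close>.\<close>

lemma trunc_mean_step:
  assumes "0 < s"
  shows "trunc_mean (2 * s) \<le> trunc_mean s + 2 * s * (1 / L s - 1 / L (2 * s))"
proof -
  let ?A = "{x \<in> space M. X 0 x \<in> {s<..2 * s}}"
  have intA: "integrable M (\<lambda>x. 2 * s * indicator ?A x)"
    by (intro integrable_mult_right integrable_real_indicator) (auto simp: emeasure_eq_measure)
  have "trunc_mean (2 * s) \<le> expectation (\<lambda>x. (if 0 < X 0 x \<and> X 0 x \<le> s then X 0 x else 0)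
      + 2 * s * indicator ?A x)"
    unfolding trunc_mean_def
    by (intro integral_mono trunc_mean_integrable Bochner_Integration.integrable_add intA)
      (use assms in \<open>auto simp: indicator_def\<close>)
  also have "\<dots> = trunc_mean s + 2 * s * prob ?A"
    unfolding trunc_mean_def
    by (subst Bochner_Integration.integral_add[OF trunc_mean_integrable intA]) simp
  finally show ?thesis
    using assms by (simp add: prob_interval del: greaterThanAtMost_iff)
qed

text \<open>Mass of a value relative to the scale \<open>a\<close>: values of size at least
  \<open>\<delta> * a\<close> count as one unit, smaller ones proportionally. Values above
  \<open>2 * a\<close> count as zero, so the mean is governed by
  \<open>trunc_mean (2 * a)\<close>.\<close>

definition cut :: "real \<Rightarrow> real \<Rightarrow> real \<Rightarrow> real" where
  "cut \<delta> a y = (if 0 < y \<and> y \<le> 2 * a then min 1 (y / (\<delta> * a)) else 0)"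

lemma cut_measurable [measurable]: "cut \<delta> a \<in> borel_measurable borel"
  unfolding cut_def by measurable

lemma cut_bounds:
  assumes "0 < \<delta>" "0 < a"
  shows "0 \<le> cut \<delta> a y" "cut \<delta> a y \<le> 1"
  using assms by (simp_all add: cut_def)

lemma expectation_cut:
  assumes "0 < \<delta>" "0 < a"
  shows "expectation (\<lambda>x. cut \<delta> a (X 0 x)) \<le> trunc_mean (2 * a) / (\<delta> * a)"
    and "integrable M (\<lambda>x. cut \<delta> a (X 0 x))"
proof -
  show int: "integrable M (\<lambda>x. cut \<delta> a (X 0 x))"
    by (rule integrable_const_bound[where B = 1]) (use cut_bounds[OF assms] in auto)
  have "expectation (\<lambda>x. cut \<delta> a (X 0 x))
      \<le> expectation (\<lambda>x. (if 0 < X 0 x \<and> X 0 x \<le> 2 * a then X 0 x else 0) / (\<delta> * a))"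
    by (intro integral_mono int integrable_divide trunc_mean_integrable) (auto simp: cut_def)
  then show "expectation (\<lambda>x. cut \<delta> a (X 0 x)) \<le> trunc_mean (2 * a) / (\<delta> * a)"
    by (simp add: trunc_mean_def)
qed

text \<open>The condition on earlier draws is a coarse record property: none of them lies above the
  dyadic layer of \<open>X j\<close>. It produces the geometric weight in \<open>j\<close> that
  keeps the union over all \<open>j < T\<close> small.\<close>

definition cluster :: "nat \<Rightarrow> nat \<Rightarrow> real \<Rightarrow> real \<Rightarrow> nat \<Rightarrow> 'a set" where
  "cluster T r \<delta> a j = {x \<in> space M. a < X j x \<and> X j x \<le> 2 * a \<and> (\<forall>l<j. X l x \<le> 2 * a) \<and>
     real r \<le> (\<Sum>l\<in>{..<T}-{j}. cut \<delta> a (X l x))}"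

lemma cluster_measurable [measurable]: "cluster T r \<delta> a j \<in> events"
  unfolding cluster_def by measurable

text \<open>Convexity of the exponential on the segment from 0 to \<open>ln b\<close> gives the
  chord \<open>c * b + (1 - c)\<close>; the term \<open>- c\<close> is dropped.\<close>

lemma powr_le_chord:
  assumes "1 \<le> (b::real)" "0 \<le> c" "c \<le> 1"
  shows "b powr c \<le> 1 + c * b"
proof -
  have "exp (c * ln b + (1 - c) * 0) \<le> c * exp (ln b) + (1 - c) * exp 0"
    using convex_onD[OF exp_convex, of "1 - c" "ln b" 0] assms by simp
  then show ?thesis using assms by (simp add: powr_def)
qed

text \<open>Exponential Markov inequality with the weight \<open>q powr (- cut)\<close>, replaced by its chord
  \<open>1 + cut / q\<close> so that only the mean of \<^const>\<open>cut\<close> enters.\<close>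
lemma prob_cluster:
  assumes "0 < \<delta>" "0 < a" "0 < q" "q < 1" "j < T" "2 \<le> L (2 * a)" "L a \<le> L (2 * a)"
  shows "prob (cluster T r \<delta> a j) \<le> q ^ r * (1 / L a - 1 / L (2 * a)) * (1 - 1 / L (2 * a)) ^ j
     * exp (2 * real T * (trunc_mean (2 * a) / (\<delta> * a)) / q)"
proof -
  define F where "F = 1 - 1 / L (2 * a)"
  define H where "H = trunc_mean (2 * a) / (\<delta> * a)"
  have F: "1/2 \<le> F" "F = prob {x \<in> space M. X 0 x \<le> 2 * a}"
    using assms by (auto simp: F_def prob_le field_simps)
  have p_nonneg: "0 \<le> 1 / L a - 1 / L (2 * a)"
    using prob_interval[of a "2 * a"] assms(2) measure_nonneg[of M] by (metis less_imp_le mult_2 less_add_same_cancel1)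
  have H: "0 \<le> H" using assms by (simp add: H_def trunc_mean_nonneg)
  \<comment> \<open>The factor at \<open>j\<close> enforces the layer, the factors before
    \<open>j\<close> enforce the record condition, and every factor other than the one at
    \<open>j\<close> carries the chord weight.\<close>
  define f where "f l y = (if l = j then indicator {a<..2*a} y
    else if l < j then indicator {..2*a} y * (1 + cut \<delta> a y / q) else 1 + cut \<delta> a y / q)" for l y
  have f_meas [measurable]: "f l \<in> borel_measurable borel" for l
    unfolding f_def by (cases "l = j"; cases "l < j") simp_all
  have cq: "0 \<le> cut \<delta> a y / q" "cut \<delta> a y / q \<le> 1 / q" for y
    using cut_bounds[OF assms(1,2), of y] assms(3) by (auto intro: divide_right_mono)
  have f_nonneg: "0 \<le> f l y" for l y
    using cq[of y] by (simp add: f_def)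
  have f_bd: "\<bar>f l y\<bar> \<le> 1 + 1 / q" for l y
    using cq[of y] assms(3) by (auto simp: f_def indicator_def)
  have int: "integrable M (\<lambda>x. q ^ r * (\<Prod>l<T. f l (X l x)))"
    by (intro integrable_mult_right expectation_prod(2)[where C = "1 + 1 / q"]) (auto intro: f_bd)
  have "prob (cluster T r \<delta> a j) = expectation (indicator (cluster T r \<delta> a j))"
    by simp
  also have "\<dots> \<le> expectation (\<lambda>x. q ^ r * (\<Prod>l<T. f l (X l x)))"
  proof (intro integral_mono int)
    fix x assume "x \<in> space M"
    show "indicator (cluster T r \<delta> a j) x \<le> q ^ r * (\<Prod>l<T. f l (X l x))"
    proof (cases "x \<in> cluster T r \<delta> a j")
      case True
      have "(1 / q) ^ r \<le> (1 / q) powr (\<Sum>l\<in>{..<T}-{j}. cut \<delta> a (X l x))"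
        using True assms by (subst powr_realpow[symmetric]) (auto simp: cluster_def intro!: powr_mono)
      also have "\<dots> = (\<Prod>l\<in>{..<T}-{j}. (1 / q) powr cut \<delta> a (X l x))"
        using assms by (intro powr_sum) auto
      also have "\<dots> \<le> (\<Prod>l\<in>{..<T}-{j}. f l (X l x))"
      proof (intro prod_mono conjI)
        fix l assume l: "l \<in> {..<T} - {j}"
        have "(1 / q) powr cut \<delta> a (X l x) \<le> 1 + cut \<delta> a (X l x) * (1 / q)"
          using assms by (intro powr_le_chord cut_bounds) auto
        then show "(1 / q) powr cut \<delta> a (X l x) \<le> f l (X l x)"
          using True l by (auto simp: f_def cluster_def)
      qed simp
      \<comment> \<open>On the event, the indicator at \<open>j\<close> equals 1 and can be
        inserted.\<close>
      also have "\<dots> = (\<Prod>l<T. f l (X l x))"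
        using True assms by (subst prod.remove[of "{..<T}" j]) (auto simp: f_def cluster_def)
      finally have "q ^ r * (1 / q) ^ r \<le> q ^ r * (\<Prod>l<T. f l (X l x))"
        using assms by (intro mult_left_mono) auto
      then show ?thesis using True assms by (simp add: power_one_over)
    qed (use f_nonneg assms in \<open>auto intro!: mult_nonneg_nonneg prod_nonneg\<close>)
  qed (auto simp: emeasure_eq_measure)
  also have "\<dots> = q ^ r * (\<Prod>l<T. expectation (\<lambda>x. f l (X 0 x)))"
    using expectation_prod(1)[where C = "1 + 1 / q" and f = f and I = "{..<T}"] f_bd by simp
  also have "\<dots> = q ^ r * (expectation (\<lambda>x. f j (X 0 x)) * (\<Prod>l\<in>{..<T}-{j}. expectation (\<lambda>x. f l (X 0 x))))"
    using assms by (subst prod.remove[of "{..<T}" j]) auto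
  also have "expectation (\<lambda>x. f j (X 0 x)) = 1 / L a - 1 / L (2 * a)"
  proof -
    have "expectation (\<lambda>x. f j (X 0 x)) = expectation (indicator {x \<in> space M. X 0 x \<in> {a<..2*a}})"
      by (intro Bochner_Integration.integral_cong) (auto simp: f_def indicator_def)
    also have "\<dots> = prob {x \<in> space M. X 0 x \<in> {a<..2*a}}" by simp
    finally show ?thesis using prob_interval[of a "2 * a"] assms by simp
  qed
  finally have *: "prob (cluster T r \<delta> a j) \<le> q ^ r * ((1 / L a - 1 / L (2 * a)) *
      (\<Prod>l\<in>{..<T}-{j}. expectation (\<lambda>x. f l (X 0 x))))" .
  have "(\<Prod>l\<in>{..<T}-{j}. expectation (\<lambda>x. f l (X 0 x)))
      \<le> (\<Prod>l\<in>{..<T}-{j}. (if l < j then F else 1) * exp (2 * H / q))"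
  proof (intro prod_mono conjI)
    fix l assume l: "l \<in> {..<T} - {j}"
    show "0 \<le> expectation (\<lambda>x. f l (X 0 x))"
      by (intro integral_nonneg_AE) (simp add: f_nonneg)
    have intc: "integrable M (\<lambda>x. cut \<delta> a (X 0 x) / q)"
      using expectation_cut(2)[OF assms(1,2)] by simp
    have Ec: "expectation (\<lambda>x. cut \<delta> a (X 0 x) / q) \<le> H / q"
      using divide_right_mono[OF expectation_cut(1)[OF assms(1,2)], of q] assms(3) by (simp add: H_def)
    have intf: "integrable M (\<lambda>x. f l (X 0 x))"
      by (rule integrable_const_bound[where B = "1 + 1 / q"]) (use f_bd in auto)
    have e1: "1 + 2 * H / q \<le> exp (2 * H / q)"
      by (rule exp_ge_add_one_self)
    show "expectation (\<lambda>x. f l (X 0 x)) \<le> (if l < j then F else 1) * exp (2 * H / q)"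
    proof (cases "l < j")
      case True
      let ?I = "indicator {x \<in> space M. X 0 x \<le> 2 * a} :: 'a \<Rightarrow> real"
      have intI: "integrable M ?I"
        by (intro integrable_real_indicator) (auto simp: emeasure_eq_measure)
      have "expectation (\<lambda>x. f l (X 0 x)) \<le> expectation (\<lambda>x. ?I x + cut \<delta> a (X 0 x) / q)"
        using True cq
        by (intro integral_mono intf Bochner_Integration.integrable_add intc intI)
          (auto simp: f_def indicator_def)
      also have "\<dots> = F + expectation (\<lambda>x. cut \<delta> a (X 0 x) / q)"
        using intI intc F(2) by simp
      also have "\<dots> \<le> F + H / q" using Ec by simp
      \<comment> \<open>Since \<open>F\<close> is at least \<open>1/2\<close>, doubling the second
        term allows \<open>F\<close> to be factored out; this is the 2 in the exponent.\<close>
      also have "\<dots> \<le> F * (1 + 2 * H / q)"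
        using mult_right_mono[of "1/2" F "2 * H / q"] F H assms(3) by (simp add: algebra_simps)
      also have "\<dots> \<le> F * exp (2 * H / q)"
        using e1 F by (intro mult_left_mono) auto
      finally show ?thesis using True by simp
    next
      case False
      then have "expectation (\<lambda>x. f l (X 0 x)) = expectation (\<lambda>x. 1 + cut \<delta> a (X 0 x) / q)"
        using l by (simp add: f_def)
      also have "\<dots> = 1 + expectation (\<lambda>x. cut \<delta> a (X 0 x) / q)"
        using intc by (subst Bochner_Integration.integral_add) (auto simp: prob_space)
      also have "\<dots> \<le> 1 + H / q" using Ec by simp
      also have "\<dots> \<le> 1 + 2 * H / q" using H assms(3) by (simp add: divide_right_mono)
      also have "\<dots> \<le> exp (2 * H / q)" by (rule e1)
      finally show ?thesis using False by simp
    qed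
  qed
  also have "(\<Prod>l\<in>{..<T}-{j}. (if l < j then F else 1) * exp (2 * H / q))
      = F ^ j * exp (2 * H / q) ^ (T - 1)"
  proof -
    have "{l \<in> {..<T} - {j}. l < j} = {..<j}" using assms by auto
    then have "(\<Prod>l\<in>{..<T}-{j}. (if l < j then F else 1)) = F ^ j"
      by (subst prod.inter_filter[symmetric]) auto
    then show ?thesis using assms by (simp add: prod.distrib)
  qed
  also have "\<dots> \<le> F ^ j * exp (2 * H / q) ^ T"
    using F H assms by (intro mult_left_mono power_increasing) auto
  also have "exp (2 * H / q) ^ T = exp (2 * real T * H / q)"
    by (simp add: exp_of_nat_mult[symmetric] mult_ac)
  finally have "(1 / L a - 1 / L (2 * a)) * (\<Prod>l\<in>{..<T}-{j}. expectation (\<lambda>x. f l (X 0 x)))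
      \<le> (1 / L a - 1 / L (2 * a)) * (F ^ j * exp (2 * real T * H / q))"
    by (rule mult_left_mono) (use p_nonneg in simp)
  then have "q ^ r * ((1 / L a - 1 / L (2 * a)) * (\<Prod>l\<in>{..<T}-{j}. expectation (\<lambda>x. f l (X 0 x))))
      \<le> q ^ r * ((1 / L a - 1 / L (2 * a)) * (F ^ j * exp (2 * real T * H / q)))"
    by (rule mult_left_mono) (use assms in simp)
  with * show ?thesis by (simp add: F_def H_def mult_ac)
qed

text \<open>Summing the geometric weights over \<open>j\<close> gives at most
  \<open>L (2 * s)\<close>, so a layer at \<open>s\<close> costs
  \<open>(L (2 * s) - L s) / L s\<close>, which bounds the expected number of such records.
  Replacing the denominator by \<open>L u\<close> makes the sum over layers telescope, so the number
  of layers does not enter.\<close>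

lemma prob_clusters:
  assumes "0 < \<delta>" "0 < u" "0 < q" "q < 1" "2 \<le> L u" "mono L"
    and A: "\<And>i. i < \<kappa> \<Longrightarrow> 2 * real T * (trunc_mean (2 * (u * 2 ^ i)) / (\<delta> * (u * 2 ^ i))) / q \<le> A"
  shows "prob (\<Union>i<\<kappa>. \<Union>j<T. cluster T r \<delta> (u * 2 ^ i) j) \<le> q ^ r * exp A * (L (u * 2 ^ \<kappa>) / L u)"
proof -
  define s where "s i = u * 2 ^ i" for i
  have s: "0 < s i" "s (Suc i) = 2 * s i" "u \<le> s i" for i
    using assms(2) mult_left_mono[of 1 "2 ^ i" u] by (auto simp: s_def)
  have Ls: "2 \<le> L (s i)" "L u \<le> L (s i)" "L (s i) \<le> L (2 * s i)" for i
    using s[of i] assms(5) monoD[OF assms(6), of u "s i"] monoD[OF assms(6), of "s i" "2 * s i"] by auto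
  have one: "prob (\<Union>j<T. cluster T r \<delta> (s i) j) \<le> q ^ r * exp A * ((L (s (Suc i)) - L (s i)) / L u)"
    if i: "i < \<kappa>" for i
  proof -
    define F where "F = 1 - 1 / L (2 * s i)"
    have L2: "2 \<le> L (2 * s i)" using Ls(1)[of "Suc i"] s by simp
    have F: "0 \<le> F" "F < 1" using L2 by (auto simp: F_def field_simps)
    have "prob (\<Union>j<T. cluster T r \<delta> (s i) j) \<le> (\<Sum>j<T. prob (cluster T r \<delta> (s i) j))"
      by (rule finite_measure_subadditive_finite) auto
    also have "\<dots> \<le> (\<Sum>j<T. q ^ r * (1 / L (s i) - 1 / L (2 * s i)) * F ^ j * exp A)"
    proof (rule sum_mono)
      fix j assume "j \<in> {..<T}"
      then have "prob (cluster T r \<delta> (s i) j) \<le> q ^ r * (1 / L (s i) - 1 / L (2 * s i)) * F ^ j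
          * exp (2 * real T * (trunc_mean (2 * s i) / (\<delta> * s i)) / q)"
        unfolding F_def using assms s L2 Ls by (intro prob_cluster) auto
      also have "\<dots> \<le> q ^ r * (1 / L (s i) - 1 / L (2 * s i)) * F ^ j * exp A"
        using A[OF i] F assms Ls[of i] L2 by (intro mult_left_mono) (auto simp: s_def frac_le)
      finally show "prob (cluster T r \<delta> (s i) j) \<le> q ^ r * (1 / L (s i) - 1 / L (2 * s i)) * F ^ j * exp A" .
    qed
    also have "\<dots> = q ^ r * exp A * (1 / L (s i) - 1 / L (2 * s i)) * (\<Sum>j<T. F ^ j)"
      unfolding sum_distrib_left by (intro sum.cong) (auto simp: mult_ac)
    also have "\<dots> \<le> q ^ r * exp A * (1 / L (s i) - 1 / L (2 * s i)) * L (2 * s i)"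
    proof (intro mult_left_mono)
      have "(\<Sum>j<T. F ^ j) \<le> (\<Sum>j. F ^ j)"
        using F by (intro sum_le_suminf summable_geometric) auto
      also have "\<dots> = L (2 * s i)"
        using F by (subst suminf_geometric) (auto simp: F_def)
      finally show "(\<Sum>j<T. F ^ j) \<le> L (2 * s i)" .
    qed (use assms Ls[of i] L2 in \<open>auto simp: frac_le\<close>)
    also have "q ^ r * exp A * (1 / L (s i) - 1 / L (2 * s i)) * L (2 * s i)
        = q ^ r * exp A * ((L (2 * s i) - L (s i)) / L (s i))"
      using L2 Ls(1)[of i] by (simp add: field_simps)
    also have "\<dots> \<le> q ^ r * exp A * ((L (2 * s i) - L (s i)) / L u)"
      using assms Ls[of i] by (intro mult_left_mono divide_left_mono) auto
    finally show ?thesis unfolding s(2) .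
  qed
  have "prob (\<Union>i<\<kappa>. \<Union>j<T. cluster T r \<delta> (s i) j) \<le> (\<Sum>i<\<kappa>. prob (\<Union>j<T. cluster T r \<delta> (s i) j))"
    by (rule finite_measure_subadditive_finite) auto
  also have "\<dots> \<le> (\<Sum>i<\<kappa>. q ^ r * exp A * ((L (s (Suc i)) - L (s i)) / L u))"
    by (intro sum_mono one) auto
  also have "\<dots> = q ^ r * exp A * ((L (s \<kappa>) - L (s 0)) / L u)"
    using sum_lessThan_telescope[of "\<lambda>i. L (s i)" \<kappa>]
    by (simp flip: sum_distrib_left sum_divide_distrib)
  also have "\<dots> \<le> q ^ r * exp A * (L (s \<kappa>) / L u)"
    using assms Ls[of 0] by (intro mult_left_mono divide_right_mono) auto
  finally show ?thesis by (simp add: s_def)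
qed

text \<open>Pathwise: take the dyadic layer of the maximum and the index \<open>j\<close> attaining
  it. The other draws carry less than \<open>r\<close> units of mass, so at most
  \<open>r - 1\<close> of them exceed \<open>\<delta> * a\<close>, each bounded by \<open>m\<close>,
  while the small ones add up to at most \<open>r * \<delta> * m\<close>.\<close>

lemma sum_le_of_not_cluster:
  assumes x: "x \<in> space M" "\<And>l. 0 < X l x" and "0 < \<delta>" "0 < u" "i < T" "1 \<le> r"
    and m: "m = Max ((\<lambda>l. X l x) ` {..i})" "u < m" "m \<le> u * 2 ^ \<kappa>"
    and nc: "x \<notin> (\<Union>i<\<kappa>. \<Union>j<T. cluster T r \<delta> (u * 2 ^ i) j)"
  shows "(\<Sum>l\<le>i. X l x) \<le> (real r + real r * \<delta>) * m"
proof -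
  have "m \<in> (\<lambda>l. X l x) ` {..i}" unfolding m(1) by (rule Max_in) auto
  then obtain j where j: "j \<le> i" "X j x = m" by auto
  have le_m: "X l x \<le> m" if "l \<le> i" for l
    unfolding m(1) using that by (intro Max_ge) auto
  \<comment> \<open>The least dyadic level above \<open>m\<close>; its predecessor \<open>n\<close>
    satisfies \<open>u * 2 ^ n < m\<close> and fixes the layer.\<close>
  define K where "K = (LEAST K. m \<le> u * 2 ^ K)"
  have K: "m \<le> u * 2 ^ K" "K \<le> \<kappa>"
    unfolding K_def using m(3) by (auto intro: LeastI Least_le)
  have "K \<noteq> 0" using K(1) m(2) by (auto intro: gr0I)
  define n where "n = K - 1"
  have n: "K = Suc n" using \<open>K \<noteq> 0\<close> by (simp add: n_def)
  have "\<not> m \<le> u * 2 ^ n"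
    using not_less_Least[of n "\<lambda>K. m \<le> u * 2 ^ K"] n by (simp add: K_def)
  define a where "a = u * 2 ^ n"
  have a: "0 < a" "a < m" "m \<le> 2 * a"
    using \<open>\<not> m \<le> u * 2 ^ n\<close> K(1) n assms(4) by (simp_all add: a_def)
  have "n < \<kappa>" using n K by simp
  then have "x \<notin> cluster T r \<delta> a j"
    using nc j(1) assms(5) unfolding a_def by auto
  then have lt: "(\<Sum>l\<in>{..<T}-{j}. cut \<delta> a (X l x)) < real r"
  proof -
    have "\<forall>l<j. X l x \<le> 2 * a" using le_m a(3) j(1) by (meson less_imp_le order_trans)
    then show ?thesis
      using \<open>x \<notin> cluster T r \<delta> a j\<close> x(1) j(2) a by (simp add: cluster_def not_le)
  qed
  let ?J = "{..i} - {j}"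
  let ?B = "{l \<in> ?J. \<delta> * a \<le> X l x}"
  \<comment> \<open>All values up to index \<open>i\<close> are at most
    \<open>m \<le> 2 * a\<close>, so the upper truncation in \<open>cut\<close> is inactive
    here.\<close>
  have cut_eq: "cut \<delta> a (X l x) = (if l \<in> ?B then 1 else X l x / (\<delta> * a))" if "l \<in> ?J" for l
  proof -
    have "X l x \<le> 2 * a" using that le_m[of l] a by auto
    moreover have "1 \<le> X l x / (\<delta> * a) \<longleftrightarrow> \<delta> * a \<le> X l x"
      using a assms(3) by (simp add: le_divide_eq_1_pos)
    ultimately show ?thesis
      using x(2)[of l] that by (simp add: cut_def min_def)
  qed
  have sum_cut: "(\<Sum>l\<in>?J. cut \<delta> a (X l x)) < real r"
  proof -
    have "(\<Sum>l\<in>?J. cut \<delta> a (X l x)) \<le> (\<Sum>l\<in>{..<T}-{j}. cut \<delta> a (X l x))"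
      using assms(5) by (intro sum_mono2) (auto intro: cut_bounds[OF assms(3) a(1)])
    then show ?thesis using lt by simp
  qed
  have "real (card ?B) = (\<Sum>l\<in>?B. cut \<delta> a (X l x))"
    using cut_eq by simp
  also have "\<dots> \<le> (\<Sum>l\<in>?J. cut \<delta> a (X l x))"
    by (intro sum_mono2) (auto intro: cut_bounds[OF assms(3) a(1)])
  finally have "card ?B < r" using sum_cut by simp
  \<comment> \<open>Integrality turns \<open>card ?B < r\<close> into \<open>r - 1\<close>; together
    with the maximum itself this gives the coefficient \<open>r\<close>.\<close>
  then have card: "real (card ?B) \<le> real r - 1" using assms(6) by linarith
  have "(\<Sum>l\<in>?J. X l x) \<le> (\<Sum>l\<in>?J. (if l \<in> ?B then m else 0) + \<delta> * a * cut \<delta> a (X l x))"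
  proof (rule sum_mono)
    fix l assume l: "l \<in> ?J"
    show "X l x \<le> (if l \<in> ?B then m else 0) + \<delta> * a * cut \<delta> a (X l x)"
    proof (cases "l \<in> ?B")
      case True
      then have "cut \<delta> a (X l x) = 1" using cut_eq[OF l] by simp
      moreover have "X l x \<le> m" using le_m[of l] l by simp
      moreover have "0 \<le> \<delta> * a" using a(1) assms(3) by simp
      ultimately show ?thesis using True by simp
    next
      case False
      then have "cut \<delta> a (X l x) = X l x / (\<delta> * a)" using cut_eq[OF l] by (simp only: if_False)
      then have "\<delta> * a * cut \<delta> a (X l x) = X l x" using a(1) assms(3) by simp
      then show ?thesis using False by (simp only: if_False)
    qed
  qed
  also have "\<dots> = real (card ?B) * m + \<delta> * a * (\<Sum>l\<in>?J. cut \<delta> a (X l x))"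
  proof -
    have "?J \<inter> {l. l \<in> ?B} = ?B" by auto
    then have "(\<Sum>l\<in>?J. if l \<in> ?B then m else 0) = real (card ?B) * m"
      by (subst sum.If_cases) simp_all
    then show ?thesis by (simp only: sum.distrib sum_distrib_left)
  qed
  also have "\<dots> \<le> (real r - 1) * m + \<delta> * m * real r"
  proof (rule add_mono)
    show "real (card ?B) * m \<le> (real r - 1) * m"
      using card a(1,2) by (intro mult_right_mono) linarith+
    have "0 \<le> (\<Sum>l\<in>?J. cut \<delta> a (X l x))"
      by (rule sum_nonneg) (rule cut_bounds[OF assms(3) a(1)])
    then show "\<delta> * a * (\<Sum>l\<in>?J. cut \<delta> a (X l x)) \<le> \<delta> * m * real r"
      using sum_cut a(1,2) assms(3) by (intro mult_mono) (simp_all add: less_imp_le)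
  qed
  finally have "(\<Sum>l\<in>?J. X l x) \<le> (real r - 1) * m + \<delta> * m * real r" .
  moreover have "(\<Sum>l\<le>i. X l x) = m + (\<Sum>l\<in>?J. X l x)"
    using j by (subst sum.remove[of _ j]) simp_all
  ultimately show ?thesis by (simp add: algebra_simps)
qed

end

section \<open>Almost sure upper bounds\<close>

locale iid_slow = iid_sequence M X + second_order_slow "tailL M (X 0)" g k
  for M :: "'a measure" and X g k
begin

section \<open>Partial sums, running maxima and the probability of a bad window\<close>

definition psum :: "nat \<Rightarrow> 'a \<Rightarrow> real" where
  "psum n x = (\<Sum>l\<le>n. X l x)"

definition pmax :: "nat \<Rightarrow> 'a \<Rightarrow> real" where
  "pmax n x = Max ((\<lambda>l. X l x) ` {..n})"

lemma psum_measurable [measurable]: "psum n \<in> borel_measurable M"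
  unfolding psum_def by measurable

lemma pmax_measurable [measurable]: "pmax n \<in> borel_measurable M"
  unfolding pmax_def by measurable

lemma pmax_le_iff: "pmax n x \<le> u \<longleftrightarrow> (\<forall>l\<le>n. X l x \<le> u)"
  unfolding pmax_def by (subst Max_le_iff) auto

lemma pmax_mono: "n \<le> n' \<Longrightarrow> pmax n x \<le> pmax n' x"
  unfolding pmax_def by (intro Max_mono) auto

lemma pmax_pos: "(\<And>l. 0 < X l x) \<Longrightarrow> 0 < pmax n x"
  using pmax_le_iff[of n x 0] by (meson leD leI le_refl)

lemma pmax_le_psum:
  assumes "\<And>l. 0 < X l x"
  shows "pmax n x \<le> psum n x"
  unfolding pmax_le_iff psum_def
  using assms by (auto intro!: member_le_sum intro: less_imp_le)

text \<open>\<open>q\<close> is left free. Taken of order \<open>T * g (U y) / y\<close>, it keeps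
  the exponential bounded, so that the bad event has probability of order \<open>q ^ r\<close> as
  long as \<open>z / y\<close> is bounded.\<close>

lemma window_bound:
  assumes \<delta>: "0 < \<delta>"
  obtains C y0 where "0 < C" "1 \<le> y0"
    "\<And>y z T r q. y0 \<le> y \<Longrightarrow> y \<le> z \<Longrightarrow> 0 < q \<Longrightarrow> q < 1 \<Longrightarrow> 1 \<le> r \<Longrightarrow>
      \<exists>A\<in>events. prob A \<le> q ^ r * exp (C * (real T * g (U y) / (y * q))) * (2 * z / y) \<and>
        (\<forall>x\<in>space M - A. (\<forall>l. 0 < X l x) \<longrightarrow> (\<forall>i<T. U y < pmax i x \<longrightarrow> pmax i x \<le> U z \<longrightarrow>
          psum i x \<le> (real r + real r * \<delta>) * pmax i x))"
proof -
  obtain K s0 where K: "0 < K" "0 < s0" "\<And>s. s0 \<le> s \<Longrightarrow> trunc_mean s \<le> K * s * g s / L s"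
    using truncated_mean_bound[of trunc_mean] trunc_mean_step trunc_mean_le by metis
  obtain u0 where u0: "0 < u0" "\<And>x. u0 \<le> x \<Longrightarrow> 0 < g x"
    "\<And>x y. u0 \<le> x \<Longrightarrow> x \<le> y \<Longrightarrow> g y \<le> g x"
    using g_decreasing by metis
  have "\<forall>\<^sub>F x in at_top. L (x * 2) / L x < 2"
    by (rule order_tendstoD(2)[OF L_slow]) auto
  then obtain u1 where u1: "\<And>x. u1 \<le> x \<Longrightarrow> L (x * 2) / L x < 2"
    by (auto simp: eventually_at_top_linorder)
  have "\<forall>\<^sub>F y in at_top. max (max 1 s0) (max u0 u1) < U y"
    using rc_inv_at_top unfolding filterlim_at_top_dense by blast
  then obtain y1 where y1: "\<And>y. y1 \<le> y \<Longrightarrow> max (max 1 s0) (max u0 u1) < U y"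
    by (auto simp: eventually_at_top_linorder)
  define y0 where "y0 = max 2 y1"
  define C where "C = 4 * K * 2 / \<delta>"
  show thesis
  proof (rule that[of C y0])
    fix y z q :: real and T r :: nat
    assume y: "y0 \<le> y" and z: "y \<le> z" and q: "0 < q" "q < 1" and r: "1 \<le> r"
    define u where "u = U y"
    have u: "1 < u" "s0 < u" "u0 < u" "u1 < u" "L u = y" "2 \<le> y" "L (U z) = z"
      using y z y1[of y] L_rc_inv[of y] L_rc_inv[of z] by (auto simp: u_def y0_def)
    obtain \<kappa>1 where "U z / u < 2 ^ \<kappa>1"
      using real_arch_pow[of 2 "U z / u"] by auto
    then have ex: "U z \<le> u * 2 ^ \<kappa>1" using u by (simp add: field_simps)
    \<comment> \<open>The first dyadic level beyond \<open>U z\<close> overshoots by less than a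
      factor 2, over which \<open>L\<close> at most doubles; hence \<open>2 * z\<close> instead of
      \<open>z\<close>.\<close>
    define \<kappa> where "\<kappa> = (LEAST \<kappa>. U z \<le> u * 2 ^ \<kappa>)"
    have \<kappa>: "U z \<le> u * 2 ^ \<kappa>" unfolding \<kappa>_def using ex by (rule LeastI)
    have s: "u \<le> u * 2 ^ i" for i :: nat
      using u mult_left_mono[OF one_le_power[of "2::real" i], of u] by (simp del: mult_le_cancel_left1)
    have L\<kappa>: "L (u * 2 ^ \<kappa>) \<le> 2 * z"
    proof (cases \<kappa>)
      case 0
      then show ?thesis using u z by simp
    next
      case (Suc n)
      have "\<not> U z \<le> u * 2 ^ n"
        using not_less_Least[of n "\<lambda>\<kappa>. U z \<le> u * 2 ^ \<kappa>"] Suc by (simp add: \<kappa>_def)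
      then have "L (u * 2 ^ n) \<le> z"
        using L_mono[of "u * 2 ^ n" "U z"] u by simp
      moreover have "L (u * 2 ^ n * 2) < 2 * L (u * 2 ^ n)"
        using u1[of "u * 2 ^ n"] s[of n] u L_pos[of "u * 2 ^ n"] by (simp add: field_simps)
      ultimately show ?thesis using Suc by (simp add: mult_ac)
    qed
    define B where "B = real T * g u / (y * q)"
    \<comment> \<open>Beyond \<open>u\<close> both \<open>g\<close> and \<open>1 / L\<close>
      decrease, so their values at \<open>u\<close> bound the exponent in every layer at
      once.\<close>
    have bound: "2 * real T * (trunc_mean (2 * (u * 2 ^ i)) / (\<delta> * (u * 2 ^ i))) / q \<le> C * B" for i
    proof -
      define s where "s = u * 2 ^ i"
      have s: "u \<le> s" "0 < s" using s[of i] u by (auto simp: s_def)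
      have "trunc_mean (2 * s) \<le> K * (2 * s) * g (2 * s) / L (2 * s)"
        using K(3)[of "2 * s"] s u by simp
      also have "\<dots> \<le> K * (2 * s) * g u / y"
        using K(1) s u u0(2)[of u] u0(3)[of u "2 * s"] L_mono[of u "2 * s"]
        by (intro frac_le mult_left_mono mult_nonneg_nonneg) auto
      finally have "trunc_mean (2 * s) / (\<delta> * s) \<le> K * (2 * s) * g u / y / (\<delta> * s)"
        using s \<delta> by (intro divide_right_mono) auto
      also have "\<dots> = 2 * K * g u / (y * \<delta>)"
        using s \<delta> u by (simp add: field_simps)
      finally have "2 * real T * (trunc_mean (2 * s) / (\<delta> * s)) / q \<le> 2 * real T * (2 * K * g u / (y * \<delta>)) / q"
        using q by (intro divide_right_mono mult_left_mono) auto
      also have "\<dots> = C * B / 2"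
        by (simp add: C_def B_def mult_ac)
      also have "\<dots> \<le> C * B"
      proof -
        have "0 \<le> C * B"
          using K(1) \<delta> q(1) u(3,6) u0(2)[of u] by (simp add: C_def B_def)
        then show ?thesis by linarith
      qed
      finally show ?thesis by (simp add: s_def)
    qed
    define A where "A = (\<Union>i<\<kappa>. \<Union>j<T. cluster T r \<delta> (u * 2 ^ i) j)"
    have "prob A \<le> q ^ r * exp (C * B) * (L (u * 2 ^ \<kappa>) / L u)"
      unfolding A_def by (intro prob_clusters) (use \<delta> u q mono_L bound in auto)
    also have "\<dots> \<le> q ^ r * exp (C * B) * (2 * z / y)"
      using L\<kappa> u q by (intro mult_left_mono) (auto simp: divide_right_mono)
    finally have "prob A \<le> q ^ r * exp (C * B) * (2 * z / y)" .
    moreover have "psum i x \<le> (real r + real r * \<delta>) * pmax i x"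
      if "x \<in> space M - A" "\<forall>l. 0 < X l x" "i < T" "U y < pmax i x" "pmax i x \<le> U z" for x i
      unfolding psum_def
    proof (rule sum_le_of_not_cluster[where u = u and \<kappa> = \<kappa> and T = T])
      show "pmax i x \<le> u * 2 ^ \<kappa>" using that(5) \<kappa> by linarith
      show "pmax i x = Max ((\<lambda>l. X l x) ` {..i})" by (rule pmax_def)
    qed (use that \<delta> u r in \<open>auto simp: A_def u_def\<close>)
    moreover have "A \<in> events" unfolding A_def by measurable
    ultimately show "\<exists>A\<in>events. prob A \<le> q ^ r * exp (C * (real T * g (U y) / (y * q))) * (2 * z / y) \<and>
        (\<forall>x\<in>space M - A. (\<forall>l. 0 < X l x) \<longrightarrow> (\<forall>i<T. U y < pmax i x \<longrightarrow> pmax i x \<le> U z \<longrightarrow>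
          psum i x \<le> (real r + real r * \<delta>) * pmax i x))"
      unfolding B_def u_def by blast
  qed (use K \<delta> in \<open>auto simp: C_def y0_def\<close>)
qed

lemma prob_pmax_le:
  assumes "1 \<le> y"
  shows "prob {x \<in> space M. pmax n x \<le> U y} \<le> exp (- real (Suc n) / y)"
proof -
  have "prob {x \<in> space M. pmax n x \<le> U y} = (1 - 1 / y) ^ Suc n"
    using prob_max_le[of "{..n}" "U y"] assms by (simp add: pmax_le_iff L_rc_inv Ball_def)
  also have "\<dots> \<le> exp (- (1 / y)) ^ Suc n"
    using exp_ge_add_one_self[of "- (1 / y)"] assms by (intro power_mono) auto
  also have "\<dots> = exp (- real (Suc n) / y)"
    by (subst exp_of_nat_mult[symmetric]) (simp add: diff_divide_distrib add_divide_distrib)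
  finally show ?thesis .
qed

lemma prob_ex_gt:
  assumes "finite I" "1 \<le> y"
  shows "prob {x \<in> space M. \<exists>l\<in>I. U y < X l x} \<le> real (card I) / y"
proof -
  have "prob {x \<in> space M. \<exists>l\<in>I. U y < X l x} = prob (\<Union>l\<in>I. {x \<in> space M. X l x \<in> {U y<..}})"
    by (intro arg_cong[where f = prob]) auto
  also have "\<dots> \<le> (\<Sum>l\<in>I. prob {x \<in> space M. X l x \<in> {U y<..}})"
    by (rule finite_measure_subadditive_finite) (use assms in auto)
  also have "\<dots> = (\<Sum>l\<in>I. 1 / y)"
  proof (intro sum.cong refl)
    fix l
    show "prob {x \<in> space M. X l x \<in> {U y<..}} = 1 / y"
      using prob_ident[of "{U y<..}" l] prob_gt[of "U y"] assms L_rc_inv by simp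
  qed
  finally show ?thesis by simp
qed

text \<open>With high probability the maximum of \<open>T = n + 1\<close> draws lies between
  \<open>U (T / c)\<close> and \<open>U (T * c)\<close>. In that window the case
  \<open>r = 1\<close> of \<open>window_bound\<close> applies with \<open>q = g (U (T / c))\<close>,
  which tends to 0.\<close>

lemma prob_psum_gt_tendsto_0:
  assumes \<delta>: "0 < \<delta>"
  shows "(\<lambda>n. prob {x \<in> space M. (1 + \<delta>) * pmax n x < psum n x}) \<longlonglongrightarrow> 0"
proof (rule LIMSEQ_I)
  fix \<eta> :: real assume \<eta>: "0 < \<eta>"
  obtain C y0 where C: "0 < C" "1 \<le> y0"
    "\<And>y z T r q. y0 \<le> y \<Longrightarrow> y \<le> z \<Longrightarrow> 0 < q \<Longrightarrow> q < 1 \<Longrightarrow> 1 \<le> r \<Longrightarrow>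
      \<exists>A\<in>events. prob A \<le> q ^ r * exp (C * (real T * g (U y) / (y * q))) * (2 * z / y) \<and>
        (\<forall>x\<in>space M - A. (\<forall>l. 0 < X l x) \<longrightarrow> (\<forall>i<T. U y < pmax i x \<longrightarrow> pmax i x \<le> U z \<longrightarrow>
          psum i x \<le> (real r + real r * \<delta>) * pmax i x))"
    using window_bound[OF \<delta>] by blast
  \<comment> \<open>Large enough that \<open>exp (- c) \<le> 1 / c \<le> \<eta> / 4\<close>, so the
    maximum misses the window on each side with probability at most
    \<open>\<eta> / 4\<close>.\<close>
  define c where "c = 4 / \<eta> + 2"
  have c: "2 < c" "1 / c \<le> \<eta> / 4" using \<eta> by (auto simp: c_def field_simps)
  have lim: "filterlim (\<lambda>n. real (Suc n) / c) at_top sequentially"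
    using c filterlim_at_top_mult_tendsto_pos[OF tendsto_const[of "1 / c"] _
        filterlim_compose[OF filterlim_real_sequentially filterlim_Suc]] by simp
  have "(\<lambda>n. g (U (real (Suc n) / c)) * (exp (C * c) * (2 * c\<^sup>2))) \<longlonglongrightarrow> 0 * (exp (C * c) * (2 * c\<^sup>2))"
    by (intro tendsto_mult tendsto_const filterlim_compose[OF g_lim]
        filterlim_compose[OF rc_inv_at_top] lim)
  then have "\<forall>\<^sub>F n in sequentially. g (U (real (Suc n) / c)) * (exp (C * c) * (2 * c\<^sup>2)) < \<eta> / 4"
    using \<eta> by (intro order_tendstoD(2)) auto
  moreover have "\<forall>\<^sub>F n in sequentially. y0 \<le> real (Suc n) / c"
    using lim by (simp add: filterlim_at_top)
  moreover have "\<forall>\<^sub>F n in sequentially. 0 < g (U (real (Suc n) / c))"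
    by (rule eventually_compose_filterlim[OF g_pos filterlim_compose[OF rc_inv_at_top lim]])
  moreover have "\<forall>\<^sub>F n in sequentially. g (U (real (Suc n) / c)) < 1"
    by (rule order_tendstoD(2)[OF filterlim_compose[OF g_lim filterlim_compose[OF rc_inv_at_top lim]]]) simp
  ultimately have "\<forall>\<^sub>F n in sequentially. prob {x \<in> space M. (1 + \<delta>) * pmax n x < psum n x} < \<eta>"
  proof eventually_elim
    case (elim n)
    define T where "T = Suc n"
    define y where "y = real T / c"
    define z where "z = real T * c"
    have yz: "y0 \<le> y" "1 \<le> y" "y \<le> z" "0 < y" "1 \<le> z"
    proof -
      show "y0 \<le> y" "1 \<le> y" using elim C by (auto simp: y_def T_def)
      then show "0 < y" by simp
      have "1 / c \<le> c" using c by (simp add: field_simps) (smt (verit) mult_le_cancel_left2)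
      then have "real T * (1 / c) \<le> real T * c" by (intro mult_left_mono) auto
      then show "y \<le> z" by (simp add: y_def z_def)
      then show "1 \<le> z" using \<open>1 \<le> y\<close> by simp
    qed
    define q where "q = g (U y)"
    have q: "0 < q" "q < 1" using elim by (auto simp: q_def y_def T_def)
    have eq: "real T * g (U y) / (y * q) = c" "2 * z / y = 2 * c\<^sup>2"
    proof -
      show "real T * g (U y) / (y * q) = c"
        using q c by (simp add: q_def[symmetric]) (simp add: y_def T_def)
      show "2 * z / y = 2 * c\<^sup>2"
        using c by (simp add: y_def z_def T_def power2_eq_square)
    qed
    obtain A where A: "A \<in> events" "prob A \<le> q ^ 1 * exp (C * c) * (2 * c\<^sup>2)"
      "\<And>x i. x \<in> space M - A \<Longrightarrow> \<forall>l. 0 < X l x \<Longrightarrow> i < T \<Longrightarrow> U y < pmax i x \<Longrightarrow> pmax i x \<le> U z \<Longrightarrow>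
          psum i x \<le> (real 1 + real 1 * \<delta>) * pmax i x"
      using C(3)[OF yz(1,3) q, of 1 T] unfolding eq by auto
    let ?B = "{x \<in> space M. pmax n x \<le> U y}" and ?D = "{x \<in> space M. \<exists>l\<in>{..n}. U z < X l x}"
    have "prob {x \<in> space M. (1 + \<delta>) * pmax n x < psum n x} \<le> prob (A \<union> (?B \<union> ?D))"
    proof (rule finite_measure_mono_AE)
      show "AE x in M. x \<in> {x \<in> space M. (1 + \<delta>) * pmax n x < psum n x} \<longrightarrow> x \<in> A \<union> (?B \<union> ?D)"
        using AE_pos
      proof eventually_elim
        case (elim x)
        have "pmax n x \<le> U z \<or> (\<exists>l\<in>{..n}. U z < X l x)"
          using pmax_le_iff[of n x "U z"] by (auto simp: not_le)
        then show ?case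
          using A(3)[of x n] elim by (auto simp: T_def not_less)
      qed
    qed (use A in measurable)
    also have "\<dots> \<le> prob A + prob (?B \<union> ?D)"
      by (rule measure_Un_le) (use A in measurable)
    also have "prob (?B \<union> ?D) \<le> prob ?B + prob ?D"
      by (rule measure_Un_le) measurable
    also have "prob ?B \<le> \<eta> / 4"
    proof -
      have "prob ?B \<le> exp (- real (Suc n) / y)" by (rule prob_pmax_le[OF yz(2)])
      also have "- real (Suc n) / y = - c"
        unfolding y_def T_def using c by (simp add: field_simps)
      also have "exp (- c) \<le> 1 / c"
      proof -
        have "c \<le> exp c" using exp_ge_add_one_self[of c] by linarith
        then show ?thesis using c by (simp add: exp_minus inverse_eq_divide frac_le)
      qed
      finally show ?thesis using c by simp
    qed
    also have "prob ?D \<le> \<eta> / 4"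
    proof -
      have "prob ?D \<le> real (card {..n}) / z" by (rule prob_ex_gt) (use yz in auto)
      also have "\<dots> = 1 / c" by (simp add: z_def T_def)
      finally show ?thesis using c by simp
    qed
    also have "prob A \<le> \<eta> / 4"
      using A(2) elim by (simp add: q_def y_def T_def mult_ac)
    finally show ?case using \<eta> by simp
  qed
  then show "\<exists>n0. \<forall>n\<ge>n0. norm (prob {x \<in> space M. (1 + \<delta>) * pmax n x < psum n x} - 0) < \<eta>"
    by (simp add: eventually_sequentially)
qed

text \<open>Convergence in probability suffices: the event that the inequality fails for all
  \<open>n \<ge> n0\<close> is contained in each single failure event, and their probabilities tend
  to 0.\<close>

lemma AE_frequently_psum_le:
  assumes \<delta>: "0 < \<delta>"
  shows "AE x in M. \<exists>\<^sub>F n in sequentially. psum n x \<le> (1 + \<delta>) * pmax n x"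
proof -
  let ?bad = "\<lambda>n. {x \<in> space M. (1 + \<delta>) * pmax n x < psum n x}"
  have "AE x in M. \<exists>n\<ge>n0. psum n x \<le> (1 + \<delta>) * pmax n x" for n0
  proof -
    let ?E = "{x \<in> space M. \<forall>n\<ge>n0. (1 + \<delta>) * pmax n x < psum n x}"
    have "prob ?E \<le> 0"
    proof (rule tendsto_lowerbound[OF prob_psum_gt_tendsto_0[OF \<delta>]])
      show "\<forall>\<^sub>F n in sequentially. prob ?E \<le> prob (?bad n)"
        using eventually_ge_at_top[of n0]
        by eventually_elim (auto intro!: finite_measure_mono)
    qed simp
    then have "?E \<in> null_sets M"
      by (intro null_setsI) (auto simp: emeasure_eq_measure measure_le_0_iff)
    from AE_not_in[OF this] show ?thesis
      by (rule AE_mp) (auto simp: not_less)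
  qed
  then have "AE x in M. \<forall>n0. \<exists>n\<ge>n0. psum n x \<le> (1 + \<delta>) * pmax n x"
    by (simp add: AE_all_countable)
  then show ?thesis by (simp add: frequently_sequentially)
qed

text \<open>Borel--Cantelli for two families: \<open>A n\<close>, a cluster in the window from
  \<open>U (exp n)\<close> to \<open>U (exp (n + 1))\<close> before time \<open>T n\<close>, and
  \<open>B n\<close>, the maximum not yet having left that window from above by time
  \<open>T n\<close>. Outside both, every late index falls into a good window.\<close>

lemma AE_eventually_psum_le:
  assumes \<delta>: "0 < \<delta>" and r: "1 \<le> r"
    and sm: "summable (\<lambda>n. (g (U (exp (real n))) * ln (real n)) ^ r)"
  shows "AE x in M. \<forall>\<^sub>F i in sequentially. psum i x \<le> (real r + real r * \<delta>) * pmax i x"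
proof -
  obtain C y0 where C: "0 < C" "1 \<le> y0"
    "\<And>y z T r q. y0 \<le> y \<Longrightarrow> y \<le> z \<Longrightarrow> 0 < q \<Longrightarrow> q < 1 \<Longrightarrow> 1 \<le> r \<Longrightarrow>
      \<exists>A\<in>events. prob A \<le> q ^ r * exp (C * (real T * g (U y) / (y * q))) * (2 * z / y) \<and>
        (\<forall>x\<in>space M - A. (\<forall>l. 0 < X l x) \<longrightarrow> (\<forall>i<T. U y < pmax i x \<longrightarrow> pmax i x \<le> U z \<longrightarrow>
          psum i x \<le> (real r + real r * \<delta>) * pmax i x))"
    using window_bound[OF \<delta>] by blast
  define q where "q n = g (U (exp (real n))) * ln (real n)" for n :: nat
  \<comment> \<open>The factor 2 makes the probability of \<open>B n\<close> at most
    \<open>1 / n ^ 2\<close>.\<close>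
  define T where "T n = nat \<lceil>2 * exp (real (Suc n)) * ln (real n)\<rceil>" for n :: nat
  have exp_lim: "filterlim (\<lambda>n. exp (real n)) at_top sequentially"
    by (intro filterlim_compose[OF exp_at_top] filterlim_real_sequentially)
  have "(\<lambda>n. q n ^ r) \<longlonglongrightarrow> 0"
    using summable_LIMSEQ_zero[OF sm] by (simp add: q_def)
  then have "\<forall>\<^sub>F n in sequentially. q n ^ r < 1"
    by (rule order_tendstoD) simp
  moreover have "\<forall>\<^sub>F n in sequentially. 0 < g (U (exp (real n)))"
    by (rule eventually_compose_filterlim[OF g_pos filterlim_compose[OF rc_inv_at_top exp_lim]])
  moreover have "\<forall>\<^sub>F n in sequentially. y0 \<le> exp (real n)"
    using exp_lim by (simp add: filterlim_at_top)
  \<comment> \<open>From 3 on, \<open>ln (real n) \<ge> 1\<close>, because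
    \<open>exp 1 \<le> 3\<close>.\<close>
  ultimately have "\<forall>\<^sub>F n in sequentially. 3 \<le> n \<and> y0 \<le> exp (real n) \<and> 0 < g (U (exp (real n))) \<and> q n ^ r < 1"
    using eventually_ge_at_top[of 3] by eventually_elim auto
  then obtain n0 where n0: "\<And>n. n0 \<le> n \<Longrightarrow> 3 \<le> n \<and> y0 \<le> exp (real n) \<and> 0 < g (U (exp (real n))) \<and> q n ^ r < 1"
    by (auto simp: eventually_sequentially)
  have ln1: "1 \<le> ln (real n)" if "3 \<le> n" for n
  proof -
    have "exp 1 \<le> real n" using exp_le that by linarith
    then show ?thesis using that by (subst ln_ge_iff) auto
  qed
  have q: "0 < q n" "q n < 1" if "n0 \<le> n" for n
  proof -
    show "0 < q n" using n0[OF that] ln1[of n] by (auto simp: q_def)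
    show "q n < 1"
    proof (rule ccontr)
      assume "\<not> q n < 1"
      then have "1 \<le> q n ^ r" by (intro one_le_power) simp
      then show False using n0[OF that] by simp
    qed
  qed
  \<comment> \<open>\<open>2 * exp 1 + 1\<close> bounds \<open>T n / (exp n * ln n)\<close>, the
    \<open>+ 1\<close> paying for the ceiling; the last factor is \<open>2 * z / y\<close>.\<close>
  define D where "D = exp (C * (2 * exp 1 + 1)) * (2 * exp 1)"
  have "\<exists>A\<in>events. (n0 \<le> n \<longrightarrow> prob A \<le> q n ^ r * D) \<and>
        (\<forall>x\<in>space M - A. n0 \<le> n \<longrightarrow> (\<forall>l. 0 < X l x) \<longrightarrow> (\<forall>i<T n. U (exp (real n)) < pmax i x \<longrightarrow> pmax i x \<le> U (exp (real (Suc n))) \<longrightarrow>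
          psum i x \<le> (real r + real r * \<delta>) * pmax i x))" for n
  proof (cases "n0 \<le> n")
    case True
    let ?y = "exp (real n)" and ?z = "exp (real (Suc n))"
    have y: "y0 \<le> ?y" "?y \<le> ?z" using n0[OF True] by auto
    obtain A where A: "A \<in> events" "prob A \<le> q n ^ r * exp (C * (real (T n) * g (U ?y) / (?y * q n))) * (2 * ?z / ?y)"
      "\<And>x i. x \<in> space M - A \<Longrightarrow> \<forall>l. 0 < X l x \<Longrightarrow> i < T n \<Longrightarrow> U ?y < pmax i x \<Longrightarrow> pmax i x \<le> U ?z \<Longrightarrow>
          psum i x \<le> (real r + real r * \<delta>) * pmax i x"
      using C(3)[OF y q[OF True] r, of "T n"] by auto
    have l: "1 \<le> ln (real n)" using ln1 n0[OF True] by simp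
    have "real (T n) * g (U ?y) / (?y * q n) = real (T n) / (?y * ln (real n))"
      using n0[OF True] by (simp add: q_def)
    also have "\<dots> \<le> (2 * ?z * ln (real n) + 1) / (?y * ln (real n))"
    proof (rule divide_right_mono)
      have "0 \<le> 2 * ?z * ln (real n)" using l by simp
      then show "real (T n) \<le> 2 * ?z * ln (real n) + 1"
        unfolding T_def by linarith
    qed (use l in simp)
    also have "\<dots> = 2 * exp 1 + 1 / (?y * ln (real n))"
      using l by (simp add: add_divide_distrib exp_add)
    also have "1 / (?y * ln (real n)) \<le> 1"
      using mult_mono[of 1 ?y 1 "ln (real n)"] l by (simp add: divide_le_eq_1)
    finally have "exp (C * (real (T n) * g (U ?y) / (?y * q n))) \<le> exp (C * (2 * exp 1 + 1))"
      using C(1) by (intro iffD2[OF exp_le_cancel_iff] mult_left_mono) auto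
    then have "q n ^ r * exp (C * (real (T n) * g (U ?y) / (?y * q n))) * (2 * ?z / ?y) \<le> q n ^ r * D"
      using q[OF True] unfolding D_def mult.assoc[of "q n ^ r"]
      by (intro mult_left_mono mult_mono) (auto simp: exp_add)
    then have "prob A \<le> q n ^ r * D" using A(2) by linarith
    then show ?thesis using A(1,3) by blast
  qed auto
  then obtain A where A: "\<And>n. A n \<in> events" "\<And>n. n0 \<le> n \<Longrightarrow> prob (A n) \<le> q n ^ r * D"
    "\<And>n x i. x \<in> space M - A n \<Longrightarrow> n0 \<le> n \<Longrightarrow> \<forall>l. 0 < X l x \<Longrightarrow> i < T n \<Longrightarrow> U (exp (real n)) < pmax i x \<Longrightarrow>
      pmax i x \<le> U (exp (real (Suc n))) \<Longrightarrow> psum i x \<le> (real r + real r * \<delta>) * pmax i x"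
    by metis
  have T_ge: "2 * exp (real (Suc n)) * ln (real n) \<le> real (T n)" for n
    unfolding T_def by linarith
  have T_pos: "0 < T n" if "n0 \<le> n" for n
  proof -
    have "0 < 2 * exp (real (Suc n)) * ln (real n)"
      using ln1[of n] n0[OF that] by simp
    then have "0 < real (T n)" using T_ge[of n] by linarith
    then show ?thesis by simp
  qed
  define B where "B n = {x \<in> space M. pmax (T n - 1) x \<le> U (exp (real (Suc n)))}" for n
  have B_meas [measurable]: "B n \<in> events" for n unfolding B_def by measurable
  have B: "prob (B n) \<le> 1 / (real n) ^ 2" if n: "n0 \<le> n" for n
  proof -
    have "prob (B n) \<le> exp (- real (T n) / exp (real (Suc n)))"
      unfolding B_def using prob_pmax_le[of "exp (real (Suc n))" "T n - 1"] T_pos[OF n] by simp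
    also have "\<dots> \<le> exp (- (2 * ln (real n)))"
      using T_ge[of n] by (simp add: field_simps)
    also have "\<dots> = 1 / (real n) ^ 2"
      using n0[OF n] by (simp add: exp_minus exp_double inverse_eq_divide)
    finally show ?thesis .
  qed
  have "AE x in M. \<forall>\<^sub>F n in sequentially. x \<in> space M - A n"
  proof (rule borel_cantelli_AE1)
    show "summable (\<lambda>n. prob (A n))"
      by (rule summable_comparison_test'[where N = n0, OF summable_mult2[OF sm]])
        (use A(2) in \<open>auto simp: q_def\<close>)
  qed (auto simp: A emeasure_eq_measure)
  moreover have "AE x in M. \<forall>\<^sub>F n in sequentially. x \<in> space M - B n"
  proof (rule borel_cantelli_AE1)
    show "summable (\<lambda>n. prob (B n))"
      by (rule summable_comparison_test'[where N = n0, OF inverse_power_summable[of 2]])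
        (use B in \<open>auto simp: inverse_eq_divide\<close>)
  qed (auto simp: emeasure_eq_measure)
  ultimately show ?thesis
    using AE_pos
  proof eventually_elim
    case (elim x)
    have "\<forall>\<^sub>F n in sequentially. x \<in> space M - A n \<and> x \<in> space M - B n \<and> n0 \<le> n"
      using elim(1,2) eventually_ge_at_top[of n0] by eventually_elim auto
    then obtain n1 where n1: "\<And>n. n1 \<le> n \<Longrightarrow> x \<in> space M - A n \<and> x \<in> space M - B n \<and> n0 \<le> n"
      by (auto simp: eventually_sequentially)
    have gt: "U (exp (real (Suc n))) < pmax (T n - 1) x" if "n1 \<le> n" for n
      using n1[OF that] by (auto simp: B_def)
    have "psum i x \<le> (real r + real r * \<delta>) * pmax i x" if i: "T n1 \<le> i" for i
    proof -
      let ?P = "\<lambda>n. pmax i x \<le> U (exp (real n))"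
      have "filterlim (\<lambda>n. U (exp (real n))) at_top sequentially"
        by (rule filterlim_compose[OF rc_inv_at_top exp_lim])
      then have "\<forall>\<^sub>F n in sequentially. ?P n"
        by (simp add: filterlim_at_top)
      then obtain N where N: "?P N" by (auto simp: eventually_sequentially)
      \<comment> \<open>The least level above the maximum locates its window. Since
        \<open>B n\<close> fails for the corresponding \<open>n\<close>, an index
        \<open>i \<ge> T n\<close> would already have a maximum beyond the window.\<close>
      define m where "m = (LEAST n. ?P n)"
      have m: "?P m" unfolding m_def using N by (rule LeastI)
      have low: "\<not> ?P n" if "n \<le> Suc n1" for n
      proof -
        have "U (exp (real n)) \<le> U (exp (real (Suc n1)))"
          using that by (intro rc_inv_mono) auto
        also have "\<dots> < pmax (T n1 - 1) x" by (rule gt) simp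
        also have "\<dots> \<le> pmax i x" using i by (intro pmax_mono) simp
        finally show ?thesis by simp
      qed
      have "Suc n1 < m" using m low by (meson not_le)
      then obtain n where n: "m = Suc n" "n1 \<le> n" by (cases m) auto
      have "U (exp (real n)) < pmax i x"
        using not_less_Least[of n ?P] n(1) by (simp add: m_def)
      moreover have "i < T n"
      proof (rule ccontr)
        assume "\<not> i < T n"
        then have "pmax (T n - 1) x \<le> pmax i x" by (intro pmax_mono) simp
        then show False using gt[OF n(2)] m n(1) by simp
      qed
      ultimately show ?thesis
        using A(3)[of x n i] n1[OF n(2)] elim(3) m n(1) by auto
    qed
    then show ?case by (auto simp: eventually_sequentially)
  qed
qed

end

section \<open>Clusters at the top of a block\<close>

text \<open>For independent trials with success probabilities \<open>p n\<close>, each summand is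
  the probability that \<open>n\<close> is the last success; together they exhaust the event of at
  least one success.\<close>

lemma sum_last_index:
  fixes p :: "nat \<Rightarrow> real"
  assumes "k \<le> m"
  shows "(\<Sum>n=k..m. p n * (\<Prod>l\<in>{n<..m}. 1 - p l)) = 1 - (\<Prod>l=k..m. 1 - p l)"
  using assms
proof (induction m rule: dec_induct)
  case base
  then show ?case by simp
next
  case (step m)
  have "(\<Sum>n=k..Suc m. p n * (\<Prod>l\<in>{n<..Suc m}. 1 - p l))
      = p (Suc m) + (\<Sum>n=k..m. p n * (\<Prod>l\<in>{n<..Suc m}. 1 - p l))"
    using step.hyps by (simp add: sum.nat_ivl_Suc')
  also have "(\<Sum>n=k..m. p n * (\<Prod>l\<in>{n<..Suc m}. 1 - p l))
      = (\<Sum>n=k..m. p n * (\<Prod>l\<in>{n<..m}. 1 - p l) * (1 - p (Suc m)))"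
  proof (intro sum.cong refl)
    fix n assume "n \<in> {k..m}"
    then have "{n<..Suc m} = insert (Suc m) {n<..m}" by auto
    then show "p n * (\<Prod>l\<in>{n<..Suc m}. 1 - p l) = p n * (\<Prod>l\<in>{n<..m}. 1 - p l) * (1 - p (Suc m))"
      by simp
  qed
  also have "\<dots> = (1 - (\<Prod>l=k..m. 1 - p l)) * (1 - p (Suc m))"
    using step.IH by (simp flip: sum_distrib_right)
  finally show ?case
    using step.hyps by (simp add: prod.nat_ivl_Suc' algebra_simps)
qed

text \<open>A second Borel--Cantelli lemma for \<open>G n \<inter> H n\<close> where the \<^term>\<open>H n\<close> need not be
  independent of each other: decompose according to the last \<^term>\<open>n\<close> for which \<^term>\<open>G n\<close> occurs,
  which involves only \<^term>\<open>H n\<close> and \<^term>\<open>G l\<close> for \<open>l \<ge> n\<close>.\<close>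
lemma (in prob_space) prob_frequently_ge:
  assumes G [measurable]: "\<And>n. G n \<in> events" and H [measurable]: "\<And>n. H n \<in> events"
    and ind: "\<And>n m. n \<le> m \<Longrightarrow> prob {x \<in> H n \<inter> G n. \<forall>l\<in>{n<..m}. x \<notin> G l}
        = prob (H n) * (prob (G n) * (\<Prod>l\<in>{n<..m}. 1 - prob (G l)))"
    and c: "0 \<le> c" "\<And>n. n0 \<le> n \<Longrightarrow> c \<le> prob (H n)"
    and div: "\<not> summable (\<lambda>n. prob (G n))"
  shows "c \<le> prob {x \<in> space M. \<exists>\<^sub>F n in sequentially. x \<in> H n \<inter> G n}"
proof -
  define V where "V k = (\<Union>n\<in>{k..}. H n \<inter> G n)" for k
  have V_meas [measurable]: "V k \<in> events" for k unfolding V_def by measurable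
  have V: "c \<le> prob (V k)" if k: "n0 \<le> k" for k
  proof (rule tendsto_upperbound)
    show "\<forall>\<^sub>F m in sequentially. c * (1 - exp (- (\<Sum>l=k..m. prob (G l)))) \<le> prob (V k)"
      using eventually_ge_at_top[of k]
    proof eventually_elim
      case (elim m)
      \<comment> \<open>Being attached to the last occurrence of \<open>G\<close> up to
        \<open>m\<close>, these events are disjoint, so their probabilities add up inside
        \<open>V k\<close>.\<close>
      define E where "E n = {x \<in> H n \<inter> G n. \<forall>l\<in>{n<..m}. x \<notin> G l}" for n
      have E_eq: "E n = {x \<in> space M. x \<in> H n \<and> x \<in> G n \<and> (\<forall>l\<in>{n<..m}. x \<notin> G l)}" for n
        using sets.sets_into_space[OF G, of n] by (auto simp: E_def)
      have E_meas [measurable]: "E n \<in> events" for n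
        unfolding E_eq by measurable
      have disj: "disjoint_family_on E {k..m}"
        unfolding disjoint_family_on_def E_def
        by (auto simp: Ball_def) (metis atLeastAtMost_iff greaterThanAtMost_iff nat_neq_iff)
      have "c * (1 - exp (- (\<Sum>l=k..m. prob (G l)))) \<le> c * (1 - (\<Prod>l=k..m. 1 - prob (G l)))"
      proof (intro mult_left_mono diff_left_mono c)
        have "(\<Prod>l=k..m. 1 - prob (G l)) \<le> (\<Prod>l=k..m. exp (- prob (G l)))"
          using exp_ge_add_one_self[of "- prob (G _)"] by (intro prod_mono) auto
        then show "(\<Prod>l=k..m. 1 - prob (G l)) \<le> exp (- (\<Sum>l=k..m. prob (G l)))"
          by (simp add: exp_sum flip: sum_negf)
      qed
      also have "\<dots> = (\<Sum>n=k..m. c * (prob (G n) * (\<Prod>l\<in>{n<..m}. 1 - prob (G l))))"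
        using sum_last_index[OF elim, of "\<lambda>n. prob (G n)"] by (simp flip: sum_distrib_left)
      also have "\<dots> \<le> (\<Sum>n=k..m. prob (E n))"
        using ind k c(2) unfolding E_def
        by (intro sum_mono) (auto intro!: mult_right_mono mult_nonneg_nonneg prod_nonneg)
      also have "\<dots> = prob (\<Union>n\<in>{k..m}. E n)"
        using disj by (intro finite_measure_finite_Union[symmetric]) auto
      also have "\<dots> \<le> prob (V k)"
        by (intro finite_measure_mono) (auto simp: V_def E_def)
      finally show ?case .
    qed
    have ns: "\<not> summable (\<lambda>i. prob (G (i + k)))"
      using div summable_iff_shift[of "\<lambda>n. prob (G n)" k] by simp
    have lim: "filterlim (\<lambda>m. \<Sum>l=k..m. prob (G l)) at_top sequentially"
      unfolding filterlim_at_top_dense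
    proof
      fix Z
      obtain N where N: "Z < (\<Sum>l<N. prob (G (l + k)))"
        using ns summableI_nonneg_bounded[of "\<lambda>l. prob (G (l + k))" Z] by (auto simp: not_le[symmetric])
      show "\<forall>\<^sub>F m in sequentially. Z < (\<Sum>l=k..m. prob (G l))"
        using eventually_ge_at_top[of "k + N"]
      proof eventually_elim
        case (elim m)
        have "(\<Sum>l<N. prob (G (l + k))) = (\<Sum>l=k..<k + N. prob (G l))"
          by (rule sum.reindex_bij_witness[of _ "\<lambda>i. i - k" "\<lambda>i. i + k"]) auto
        also have "\<dots> \<le> (\<Sum>l=k..m. prob (G l))"
          using elim by (intro sum_mono2) auto
        finally show ?case using N by simp
      qed
    qed
    have "((\<lambda>m. c * (1 - exp (- (\<Sum>l=k..m. prob (G l))))) \<longlongrightarrow> c * (1 - 0)) sequentially"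
      by (intro tendsto_intros filterlim_compose[OF exp_at_bot]
          filterlim_compose[OF filterlim_uminus_at_bot_at_top] lim)
    then show "((\<lambda>m. c * (1 - exp (- (\<Sum>l=k..m. prob (G l))))) \<longlongrightarrow> c) sequentially" by simp
  qed simp
  have "decseq V"
    unfolding V_def decseq_def by (intro allI impI UN_mono) auto
  then have "(\<lambda>k. prob (V k)) \<longlonglongrightarrow> prob (\<Inter>k. V k)"
    by (intro finite_Lim_measure_decseq) auto
  then have "c \<le> prob (\<Inter>k. V k)"
    by (rule tendsto_lowerbound) (use V in \<open>auto intro: eventually_sequentiallyI\<close>)
  also have "(\<Inter>k. V k) = {x \<in> space M. \<exists>\<^sub>F n in sequentially. x \<in> H n \<inter> G n}"
    using sets.sets_into_space[OF G] by (fastforce simp: V_def frequently_sequentially)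
  finally show ?thesis .
qed

section \<open>Independent blocks and layers of a block\<close>

context iid_sequence
begin

lemma prob_blocks:
  assumes J: "finite J" "J \<noteq> {}" and K: "disjoint_family_on K J"
    and A: "\<And>j. j \<in> J \<Longrightarrow> A j \<in> sets (PiM (K j) (\<lambda>_. borel))"
  shows "prob {x \<in> space M. \<forall>j\<in>J. restrict (\<lambda>i. X i x) (K j) \<in> A j}
      = (\<Prod>j\<in>J. prob {x \<in> space M. restrict (\<lambda>i. X i x) (K j) \<in> A j})"
proof -
  have ind: "indep_vars (\<lambda>j. PiM (K j) (\<lambda>_. borel)) (\<lambda>j x. restrict (\<lambda>i. X i x) (K j)) J"
    by (rule indep_vars_restrict[OF indep _ K]) simp
  have "prob (\<Inter>j\<in>J. (\<lambda>x. restrict (\<lambda>i. X i x) (K j)) -` A j \<inter> space M)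
     = (\<Prod>j\<in>J. prob ((\<lambda>x. restrict (\<lambda>i. X i x) (K j)) -` A j \<inter> space M))"
    by (rule indep_varsD[OF ind J(2,1)]) (use A in auto)
  moreover have "(\<Inter>j\<in>J. (\<lambda>x. restrict (\<lambda>i. X i x) (K j)) -` A j \<inter> space M)
      = {x \<in> space M. \<forall>j\<in>J. restrict (\<lambda>i. X i x) (K j) \<in> A j}"
    using J by auto
  moreover have "(\<lambda>x. restrict (\<lambda>i. X i x) (K j)) -` A j \<inter> space M
      = {x \<in> space M. restrict (\<lambda>i. X i x) (K j) \<in> A j}" for j
    by auto
  ultimately show ?thesis by simp
qed

text \<open>The \<open>r\<close> largest values of the block share one layer, and all others lie at
  or below its lower edge. Stated for an arbitrary sequence \<open>w\<close>, it describes both an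
  event and a measurable set of the product space over \<open>B\<close>.\<close>

definition top_cluster :: "nat set \<Rightarrow> nat \<Rightarrow> (nat \<Rightarrow> real) \<Rightarrow> nat \<Rightarrow> (nat \<Rightarrow> real) \<Rightarrow> bool" where
  "top_cluster B r s \<kappa> w \<longleftrightarrow> (\<exists>i\<in>{..<\<kappa>}. \<exists>J\<in>{J. J \<subseteq> B \<and> card J = r}. 
     \<forall>j\<in>B. w j \<in> (if j \<in> J then {s i<..s (Suc i)} else {..s i}))"

lemma top_cluster_restrict: "top_cluster B r s \<kappa> (restrict w B) \<longleftrightarrow> top_cluster B r s \<kappa> w"
  unfolding top_cluster_def by simp

lemma top_cluster_sets:
  assumes "finite B"
  shows "{w \<in> space (PiM B (\<lambda>_. borel)). top_cluster B r s \<kappa> w} \<in> sets (PiM B (\<lambda>_. borel))"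
proof -
  have fin: "finite {J. J \<subseteq> B \<and> card J = r}" using assms by simp
  have [measurable]: "(if j \<in> J then {s i<..s (Suc i)} else {..s i}) \<in> sets borel" for i j J
    by simp
  show ?thesis
    unfolding top_cluster_def using assms fin by measurable
qed

text \<open>The probability is exact because the events for distinct pairs of layer and index set
  are disjoint: as \<open>r \<ge> 1\<close>, the layer is that of the largest value, and the index
  set consists of the draws inside it.\<close>

lemma prob_top_cluster:
  assumes B: "finite B" and r: "1 \<le> r" and s: "incseq s"
  shows "prob {x \<in> space M. top_cluster B r s \<kappa> (\<lambda>i. X i x)}
    = (\<Sum>i<\<kappa>. real (card B choose r) * (1 / L (s i) - 1 / L (s (Suc i))) ^ r * (1 - 1 / L (s i)) ^ (card B - r))"
proof -
  let ?S = "{J. J \<subseteq> B \<and> card J = r}"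
  define E where "E = (\<lambda>(i, J). {x \<in> space M. \<forall>j\<in>B. X j x \<in> (if j \<in> J then {s i<..s (Suc i)} else {..s i})})"
  have fin: "finite ?S" using B by simp
  have E_meas: "E z \<in> events" for z
    using B by (cases z) (auto simp: E_def)
  have no: False if x: "x \<in> E (i, J)" "x \<in> E (i', J')" and J': "J' \<in> ?S" and i: "i < i'" for x i i' J J'
  proof -
    have "J' \<noteq> {}" using J' r by auto
    then obtain j where j: "j \<in> J'" "j \<in> B" using J' by auto
    have "s i' < X j x" using x(2) j by (auto simp: E_def)
    moreover have "X j x \<le> max (s i) (s (Suc i))" using x(1) j(2) by (auto simp: E_def split: if_splits)
    moreover have "s i \<le> s i'" "s (Suc i) \<le> s i'" using i s by (auto simp: incseq_def)
    ultimately show False by auto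
  qed
  have disj: "disjoint_family_on E ({..<\<kappa>} \<times> ?S)"
  proof (unfold disjoint_family_on_def, intro ballI impI, rule ccontr)
    fix z z' assume z: "z \<in> {..<\<kappa>} \<times> ?S" "z' \<in> {..<\<kappa>} \<times> ?S" "z \<noteq> z'" "E z \<inter> E z' \<noteq> {}"
    obtain i J i' J' where eq: "z = (i, J)" "z' = (i', J')" by (metis surj_pair)
    obtain x where x: "x \<in> E (i, J)" "x \<in> E (i', J')" using z(4) eq by auto
    have "i = i'"
      using no[OF x] no[OF x(2,1)] z(1,2) eq by (metis linorder_neqE_nat mem_Sigma_iff)
    then have "J \<noteq> J'" using z(3) eq by simp
    then obtain j where "j \<in> B" "j \<in> J \<longleftrightarrow> j \<notin> J'" using z(1,2) eq by auto
    with x \<open>i = i'\<close> show False by (force simp: E_def split: if_splits)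
  qed
  have "{x \<in> space M. top_cluster B r s \<kappa> (\<lambda>i. X i x)} = (\<Union>z\<in>{..<\<kappa>} \<times> ?S. E z)"
    unfolding top_cluster_def E_def by auto
  then have "prob {x \<in> space M. top_cluster B r s \<kappa> (\<lambda>i. X i x)} = (\<Sum>z\<in>{..<\<kappa>} \<times> ?S. prob (E z))"
    using disj fin E_meas by (simp add: finite_measure_finite_Union image_subset_iff)
  also have "\<dots> = (\<Sum>i<\<kappa>. \<Sum>J\<in>?S. prob (E (i, J)))"
    by (simp add: sum.cartesian_product)
  also have "\<dots> = (\<Sum>i<\<kappa>. \<Sum>J\<in>?S. (1 / L (s i) - 1 / L (s (Suc i))) ^ r * (1 - 1 / L (s i)) ^ (card B - r))"
  proof (intro sum.cong refl)
    fix i J assume J: "J \<in> ?S"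
    have "prob (E (i, J)) = (\<Prod>j\<in>B. prob {x \<in> space M. X 0 x \<in> (if j \<in> J then {s i<..s (Suc i)} else {..s i})})"
      unfolding E_def prod.case by (rule prob_Ball[OF B]) simp
    also have "\<dots> = (\<Prod>j\<in>B. if j \<in> J then 1 / L (s i) - 1 / L (s (Suc i)) else 1 - 1 / L (s i))"
    proof (intro prod.cong refl)
      fix j
      show "prob {x \<in> space M. X 0 x \<in> (if j \<in> J then {s i<..s (Suc i)} else {..s i})}
        = (if j \<in> J then 1 / L (s i) - 1 / L (s (Suc i)) else 1 - 1 / L (s i))"
        using prob_interval[of "s i" "s (Suc i)"] prob_le[of "s i"] s by (auto simp: incseq_SucD)
    qed
    also have "\<dots> = (\<Prod>j\<in>J. 1 / L (s i) - 1 / L (s (Suc i))) * (\<Prod>j\<in>B - J. 1 - 1 / L (s i))"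
    proof -
      have "B \<inter> {j. j \<in> J} = J" "B \<inter> - {j. j \<in> J} = B - J" using J by auto
      then show ?thesis using B by (simp only: prod.If_cases)
    qed
    also have "\<dots> = (1 / L (s i) - 1 / L (s (Suc i))) ^ r * (1 - 1 / L (s i)) ^ (card B - r)"
    proof -
      have "finite J" using J B finite_subset by auto
      then have "card (B - J) = card B - r" using J by (auto simp: card_Diff_subset)
      then show ?thesis using J by simp
    qed
    finally show "prob (E (i, J)) = (1 / L (s i) - 1 / L (s (Suc i))) ^ r * (1 - 1 / L (s i)) ^ (card B - r)" .
  qed
  also have "\<dots> = (\<Sum>i<\<kappa>. real (card B choose r) * (1 / L (s i) - 1 / L (s (Suc i))) ^ r * (1 - 1 / L (s i)) ^ (card B - r))"
    by (simp add: n_subsets[OF B] mult_ac)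
  finally show ?thesis .
qed

text \<open>Instance of \<open>prob_frequently_ge\<close>: \<open>H n\<close> depends only on draws
  before \<open>t n\<close>, and the cluster events from \<open>n\<close> on live on the disjoint
  blocks that follow, which gives the required product formula.\<close>

lemma frequently_top_cluster:
  fixes t :: "nat \<Rightarrow> nat" and s :: "nat \<Rightarrow> nat \<Rightarrow> real" and \<kappa> :: "nat \<Rightarrow> nat" and u :: "nat \<Rightarrow> real"
  assumes t: "mono t" and c: "0 \<le> c"
    and H: "\<And>n. n0 \<le> n \<Longrightarrow> c \<le> prob {x \<in> space M. \<forall>l<t n. X l x \<le> u n}"
    and div: "\<not> summable (\<lambda>n. prob {x \<in> space M. top_cluster {t n..<t (Suc n)} r (s n) (\<kappa> n) (\<lambda>i. X i x)})"
  shows "c \<le> prob {x \<in> space M. \<exists>\<^sub>F n in sequentially.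
    (\<forall>l<t n. X l x \<le> u n) \<and> top_cluster {t n..<t (Suc n)} r (s n) (\<kappa> n) (\<lambda>i. X i x)}"
proof -
  let ?G = "\<lambda>n. {x \<in> space M. top_cluster {t n..<t (Suc n)} r (s n) (\<kappa> n) (\<lambda>i. X i x)}"
  let ?H = "\<lambda>n. {x \<in> space M. \<forall>l<t n. X l x \<le> u n}"
  define AG where "AG n = {w \<in> space (PiM {t n..<t (Suc n)} (\<lambda>_. borel)).
    top_cluster {t n..<t (Suc n)} r (s n) (\<kappa> n) w}" for n
  have AG_sets: "AG n \<in> sets (PiM {t n..<t (Suc n)} (\<lambda>_. borel))" for n
    unfolding AG_def by (rule top_cluster_sets) simp
  have in_AG: "restrict (\<lambda>i. X i x) {t n..<t (Suc n)} \<in> AG n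
      \<longleftrightarrow> top_cluster {t n..<t (Suc n)} r (s n) (\<kappa> n) (\<lambda>i. X i x)" for n x
    by (simp add: AG_def top_cluster_restrict space_PiM)
  define AH where "AH n = {w \<in> space (PiM {..<t n} (\<lambda>_. borel)). \<forall>l\<in>{..<t n}. w l \<le> u n}" for n
  have AH_sets: "AH n \<in> sets (PiM {..<t n} (\<lambda>_. borel))" for n
    unfolding AH_def by measurable
  have in_AH: "restrict (\<lambda>i. X i x) {..<t n} \<in> AH n \<longleftrightarrow> (\<forall>l<t n. X l x \<le> u n)" for n x
    by (auto simp: AH_def space_PiM)
  have G_meas [measurable]: "?G n \<in> events" for n
  proof -
    have R: "(\<lambda>x. restrict (\<lambda>i. X i x) {t n..<t (Suc n)}) \<in> measurable M (PiM {t n..<t (Suc n)} (\<lambda>_. borel))"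
      by (rule measurable_restrict) simp
    have "?G n = (\<lambda>x. restrict (\<lambda>i. X i x) {t n..<t (Suc n)}) -` AG n \<inter> space M"
      using in_AG by auto
    also have "\<dots> \<in> events" by (rule measurable_sets[OF R AG_sets])
    finally show ?thesis .
  qed
  have H_meas [measurable]: "?H n \<in> events" for n by measurable
  have "c \<le> prob {x \<in> space M. \<exists>\<^sub>F n in sequentially. x \<in> ?H n \<inter> ?G n}"
  proof (rule prob_frequently_ge[OF G_meas H_meas _ c H div])
    fix n m :: nat assume nm: "n \<le> m"
    \<comment> \<open>The blocks use the labels from \<open>n\<close> to \<open>m\<close>, so
      \<open>Suc m\<close> is free to label the initial segment.\<close>
    define K where "K j = (if j = Suc m then {..<t n} else {t j..<t (Suc j)})" for j
    define A where "A j = (if j = Suc m then AH n else if j = n then AG n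
        else space (PiM (K j) (\<lambda>_. borel)) - AG j)" for j
    have disj: "disjoint_family_on K {n..Suc m}"
      unfolding disjoint_family_on_def
    proof (intro ballI impI)
      have lt: "K a \<inter> K b = {}" if "a \<in> {n..Suc m}" "b \<in> {n..Suc m}" "a < b" for a b
      proof -
        have "t n \<le> t a" "t (Suc a) \<le> t b"
          using that t by (auto intro!: monoD[OF t])
        then show ?thesis using that by (auto simp: K_def)
      qed
      fix a b assume "a \<in> {n..Suc m}" "b \<in> {n..Suc m}" "a \<noteq> b"
      then show "K a \<inter> K b = {}" using lt[of a b] lt[of b a] by (cases "a < b") auto
    qed
    have A_sets: "A j \<in> sets (PiM (K j) (\<lambda>_. borel))" for j
      using AG_sets AH_sets by (auto simp: A_def K_def)
    have in_A: "restrict (\<lambda>i. X i x) (K j) \<in> A j \<longleftrightarrow>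
      (if j = Suc m then (\<forall>l<t n. X l x \<le> u n)
       else if j = n then top_cluster {t n..<t (Suc n)} r (s n) (\<kappa> n) (\<lambda>i. X i x)
       else \<not> top_cluster {t j..<t (Suc j)} r (s j) (\<kappa> j) (\<lambda>i. X i x))" for j x
      using in_AG[of x j] in_AG[of x n] in_AH[of x n] by (simp add: A_def K_def space_PiM)
    have split: "{n..Suc m} = insert (Suc m) (insert n {n<..m})" using nm by auto
    have "{x \<in> ?H n \<inter> ?G n. \<forall>l\<in>{n<..m}. x \<notin> ?G l}
        = {x \<in> space M. \<forall>j\<in>{n..Suc m}. restrict (\<lambda>i. X i x) (K j) \<in> A j}"
      unfolding in_A split using nm by (auto split: if_splits)
    also have "prob \<dots> = (\<Prod>j\<in>{n..Suc m}. prob {x \<in> space M. restrict (\<lambda>i. X i x) (K j) \<in> A j})"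
      using nm by (intro prob_blocks disj A_sets) auto
    also have "\<dots> = (\<Prod>j\<in>{n..Suc m}. if j = Suc m then prob (?H n) else if j = n then prob (?G n) else 1 - prob (?G j))"
    proof (intro prod.cong refl)
      fix j
      show "prob {x \<in> space M. restrict (\<lambda>i. X i x) (K j) \<in> A j}
        = (if j = Suc m then prob (?H n) else if j = n then prob (?G n) else 1 - prob (?G j))"
        unfolding in_A using prob_neg[OF G_meas[of j]] by simp
    qed
    also have "\<dots> = prob (?H n) * (prob (?G n) * (\<Prod>l\<in>{n<..m}. 1 - prob (?G l)))"
    proof -
      have "Suc m \<notin> insert n {n<..m}" "n \<notin> {n<..m}" using nm by auto
      moreover have "(\<Prod>j\<in>{n<..m}. if j = Suc m then prob (?H n) else if j = n then prob (?G n) else 1 - prob (?G j))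
        = (\<Prod>l\<in>{n<..m}. 1 - prob (?G l))"
        by (intro prod.cong) auto
      ultimately show ?thesis unfolding split using nm by simp
    qed
    finally show "prob {x \<in> ?H n \<inter> ?G n. \<forall>l\<in>{n<..m}. x \<notin> ?G l}
        = prob (?H n) * (prob (?G n) * (\<Prod>l\<in>{n<..m}. 1 - prob (?G l)))" .
  qed
  also have "{x \<in> space M. \<exists>\<^sub>F n in sequentially. x \<in> ?H n \<inter> ?G n}
      = {x \<in> space M. \<exists>\<^sub>F n in sequentially.
        (\<forall>l<t n. X l x \<le> u n) \<and> top_cluster {t n..<t (Suc n)} r (s n) (\<kappa> n) (\<lambda>i. X i x)}"
    by (auto elim!: frequently_elim1)
  finally show ?thesis .
qed

end

section \<open>Almost sure lower bound\<close>

lemma exp_minus_two_le: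
  fixes x :: real
  assumes "0 \<le> x" "x \<le> 1/2"
  shows "exp (- (2 * x)) \<le> 1 - x"
proof -
  have "1 \<le> (1 - x) * (1 + 2 * x)"
    using mult_nonneg_nonneg[of x "1 - 2 * x"] assms by (simp add: algebra_simps)
  also have "\<dots> \<le> (1 - x) * exp (2 * x)"
    using exp_ge_add_one_self[of "2 * x"] assms by (intro mult_left_mono) auto
  finally show ?thesis by (simp add: exp_minus field_simps)
qed

context iid_slow
begin

text \<open>Layers of ratio \<open>c\<close> start at \<open>U E\<close>. A layer of mass
  \<open>p i\<close> holds the top \<open>r\<close> values with probability of order
  \<open>(E * p i) ^ r\<close>. Each \<open>p i\<close> is at least of order \<open>g' / E\<close>,
  while their sum is at least \<open>1 / (2 * E)\<close>, which leaves
  \<open>g' ^ (r - 1)\<close>.\<close>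

lemma scale_cluster_bound:
  fixes n r :: nat and c \<eta> :: real
  defines "E \<equiv> exp (real n)" and "g' \<equiv> g (U (exp (real (Suc n))))"
  assumes c: "1 < c" and r: "1 \<le> r" and \<eta>: "0 < \<eta>" "\<eta> \<le> 1"
    and u0: "0 < U E" and g_dec: "\<And>x y. U E \<le> x \<Longrightarrow> x \<le> y \<Longrightarrow> g y \<le> g x" and g': "0 \<le> g'"
    and L_ratio: "\<And>x. U E \<le> x \<Longrightarrow> L (x * c) / L x < 5/4"
    and k_ratio: "\<And>x. U E \<le> x \<Longrightarrow> k c / 2 * g x \<le> L (x * c) / L x - 1"
    and E: "2 * real r \<le> \<eta> * E"
    and B: "finite B" "\<eta> * E / 2 \<le> real (card B)" "real (card B) \<le> exp 1 * E"
  obtains \<kappa> where "(\<eta> / (2 * real r)) ^ r * (k c / (2 * exp 1)) ^ (r - 1) * exp (- (2 * exp 1)) / 2 * g' ^ (r - 1)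
    \<le> prob {x \<in> space M. top_cluster B r (\<lambda>i. U E * c ^ i) \<kappa> (\<lambda>i. X i x)}"
proof -
  define s where "s i = U E * c ^ i" for i
  have E2: "2 \<le> E"
  proof -
    have "\<eta> * E \<le> 1 * E" using \<eta> by (intro mult_right_mono) (auto simp: E_def)
    then show ?thesis using E r by linarith
  qed
  have LE: "L (U E) = E" using L_rc_inv[of E] E2 by simp
  have s_Suc: "s (Suc i) = s i * c" for i by (simp add: s_def)
  have c_pow: "1 \<le> c ^ i" for i using c by (simp add: one_le_power)
  have s_ge: "U E \<le> s i" for i
    using u0 mult_left_mono[OF c_pow[of i], of "U E"] by (simp add: s_def del: mult_le_cancel_left1)
  have s_pos: "0 < s i" for i using s_ge[of i] u0 by linarith
  have inc: "incseq s"
    using s_pos c by (intro incseq_SucI) (simp add: s_Suc less_imp_le)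
  have Ls: "E \<le> L (s i)" for i using L_mono[OF s_ge[of i]] LE by simp
  obtain K where "U (2 * E) / U E < c ^ K" using real_arch_pow[OF c] by blast
  then have "U (2 * E) \<le> s K" using u0 by (simp add: s_def field_simps)
  then have ex: "2 * E \<le> L (s K)" using L_mono[of "U (2 * E)" "s K"] L_rc_inv[of "2 * E"] E2 by simp
  \<comment> \<open>Stopping once \<open>L\<close> has doubled leaves total mass at least
    \<open>1 / E - 1 / (2 * E)\<close> while every layer stays at scale \<open>E\<close>.\<close>
  define \<kappa> where "\<kappa> = (LEAST i. 2 * E \<le> L (s i))"
  have \<kappa>: "2 * E \<le> L (s \<kappa>)" unfolding \<kappa>_def using ex by (rule LeastI)
  have less: "L (s i) < 2 * E" if "i < \<kappa>" for i
    using not_less_Least[of i "\<lambda>i. 2 * E \<le> L (s i)"] that by (simp add: \<kappa>_def)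
  define p where "p i = 1 / L (s i) - 1 / L (s (Suc i))" for i
  define c0 where "c0 = k c / (2 * exp 1)"
  have c0: "0 < c0" using k_pos[OF c] by (simp add: c0_def)
  have e25: "5/2 \<le> exp (1::real)" using exp_lower_Taylor_quadratic[of 1] by simp
  have p_lower: "c0 * g' / E \<le> p i" if i: "i < \<kappa>" for i
  proof -
    have pos: "0 < L (s i)" "0 < L (s (Suc i))" "0 < E" using Ls E2 by (smt (verit))+
    \<comment> \<open>Since \<open>5/4 * 2 = 5/2 \<le> exp 1\<close>, the upper edge of each layer
      remains below \<open>U (exp (n + 1))\<close>, where monotonicity gives
      \<open>g \<ge> g'\<close>.\<close>
    have "L (s (Suc i)) < 5/4 * L (s i)"
      using L_ratio[OF s_ge[of i]] pos by (simp add: s_Suc field_simps)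
    also have "\<dots> \<le> 5/4 * (2 * E)" using less[OF i] by simp
    also have "\<dots> \<le> exp 1 * E" using e25 pos by simp
    finally have Lb: "L (s (Suc i)) < exp 1 * E" .
    have "s (Suc i) < U (exp (real (Suc n)))"
    proof (rule rc_inv_gt)
      show "L (s (Suc i)) < exp (real (Suc n))" using Lb by (simp add: E_def exp_add)
    qed simp
    moreover have "s i \<le> s (Suc i)" using inc by (simp add: incseq_SucD)
    ultimately have gs: "g' \<le> g (s i)"
      unfolding g'_def by (intro g_dec s_ge) auto
    have "c0 * g' / E = (k c / 2 * g') / (exp 1 * E)" by (simp add: c0_def)
    also have "\<dots> \<le> (L (s i * c) / L (s i) - 1) / L (s (Suc i))"
    proof (rule frac_le)
      have "k c / 2 * g' \<le> k c / 2 * g (s i)" using gs k_pos[OF c] by (intro mult_left_mono) auto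
      then show "k c / 2 * g' \<le> L (s i * c) / L (s i) - 1" using k_ratio[OF s_ge[of i]] by linarith
      show "0 \<le> L (s i * c) / L (s i) - 1"
        using k_ratio[OF s_ge[of i]] k_pos[OF c] gs g' by (smt (verit) mult_nonneg_nonneg half_gt_zero)
    qed (use pos Lb in auto)
    also have "\<dots> = p i" using pos by (simp add: p_def s_Suc field_simps)
    finally show ?thesis .
  qed
  have p_sum: "1 / (2 * E) \<le> (\<Sum>i<\<kappa>. p i)"
  proof -
    have "(\<Sum>i<\<kappa>. p i) = 1 / L (s 0) - 1 / L (s \<kappa>)"
      unfolding p_def using sum_lessThan_telescope'[of "\<lambda>i. 1 / L (s i)" \<kappa>] by simp
    moreover have "1 / L (s \<kappa>) \<le> 1 / (2 * E)" using \<kappa> E2 by (intro divide_left_mono) auto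
    moreover have "1 / L (s 0) = 1 / E" using LE by (simp add: s_def)
    moreover have "1 / E = 1 / (2 * E) + 1 / (2 * E)" using E2 by (simp add: field_simps)
    ultimately show ?thesis by linarith
  qed
  have rB: "r \<le> card B"
    using E B(2) by linarith
  define b where "b = card B"
  \<comment> \<open>One factor of \<open>p i ^ r\<close> is kept for the sum over layers; the other
    \<open>r - 1\<close> are replaced by their uniform lower bound.\<close>
  define Q where "Q = (\<eta> * E / (2 * real r)) ^ r * (c0 * g' / E) ^ (r - 1) * exp (- (2 * exp 1))"
  have Q: "0 \<le> Q" unfolding Q_def using \<eta> E2 c0 g' by (intro mult_nonneg_nonneg) auto
  have summand: "Q * p i \<le> real (b choose r) * p i ^ r * (1 - 1 / L (s i)) ^ (b - r)" if i: "i < \<kappa>" for i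
  proof -
    have p_nonneg: "0 \<le> p i" using p_lower[OF i] c0 g' E2 by (smt (verit) divide_nonneg_nonneg mult_nonneg_nonneg)
    have "(\<eta> * E / (2 * real r)) ^ r \<le> (real b / real r) ^ r"
      using B(2) \<eta> E2 r by (intro power_mono) (auto simp: b_def field_simps)
    also have "\<dots> \<le> real (b choose r)"
      using binomial_ge_n_over_k_pow_k[of r b, where ?'a = real] rB by (simp add: b_def)
    finally have 1: "(\<eta> * E / (2 * real r)) ^ r \<le> real (b choose r)" .
    have 2: "(c0 * g' / E) ^ (r - 1) * p i \<le> p i ^ r"
    proof -
      have "(c0 * g' / E) ^ (r - 1) * p i \<le> p i ^ (r - 1) * p i"
        using p_lower[OF i] p_nonneg c0 g' E2 by (intro mult_right_mono power_mono) auto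
      also have "\<dots> = p i ^ r" using r by (cases r) (auto simp: mult.commute)
      finally show ?thesis .
    qed
    have 3: "exp (- (2 * exp 1)) \<le> (1 - 1 / L (s i)) ^ (b - r)"
    proof -
      have "- (2 * exp 1) \<le> real b * - (2 * (1 / E))"
        using B(3) E2 by (simp add: b_def field_simps)
      then have "exp (- (2 * exp 1)) \<le> exp (real b * - (2 * (1 / E)))" by simp
      also have "\<dots> = exp (- (2 * (1 / E))) ^ b" by (rule exp_of_nat_mult)
      also have "\<dots> \<le> (1 - 1 / E) ^ b"
        using E2 by (intro power_mono exp_minus_two_le) auto
      also have "\<dots> \<le> (1 - 1 / E) ^ (b - r)"
        using E2 by (intro power_decreasing) auto
      also have "\<dots> \<le> (1 - 1 / L (s i)) ^ (b - r)"
        using E2 Ls[of i] by (intro power_mono diff_left_mono divide_left_mono) auto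
      finally show ?thesis .
    qed
    have "Q * p i = (\<eta> * E / (2 * real r)) ^ r * ((c0 * g' / E) ^ (r - 1) * p i) * exp (- (2 * exp 1))"
      by (simp add: Q_def mult_ac)
    also have "\<dots> \<le> real (b choose r) * p i ^ r * (1 - 1 / L (s i)) ^ (b - r)"
      using 1 2 3 p_nonneg \<eta> E2 c0 g' r
      by (intro mult_mono mult_nonneg_nonneg) auto
    finally show ?thesis .
  qed
  show thesis
  proof (rule that[of \<kappa>])
    obtain r' where r': "r = Suc r'" using r by (cases r) auto
    have "(\<eta> / (2 * real r)) ^ r * c0 ^ (r - 1) * exp (- (2 * exp 1)) / 2 * g' ^ (r - 1) = Q * (1 / (2 * E))"
      using E2 unfolding r' Q_def by (simp add: power_mult_distrib power_divide field_simps)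
    also have "\<dots> \<le> Q * (\<Sum>i<\<kappa>. p i)" using p_sum Q by (rule mult_left_mono)
    also have "\<dots> \<le> (\<Sum>i<\<kappa>. real (b choose r) * p i ^ r * (1 - 1 / L (s i)) ^ (b - r))"
      unfolding sum_distrib_left by (intro sum_mono summand) simp
    also have "\<dots> = prob {x \<in> space M. top_cluster B r s \<kappa> (\<lambda>i. X i x)}"
      unfolding p_def b_def by (rule prob_top_cluster[OF B(1) r inc, symmetric])
    finally show "(\<eta> / (2 * real r)) ^ r * (k c / (2 * exp 1)) ^ (r - 1) * exp (- (2 * exp 1)) / 2 * g' ^ (r - 1)
      \<le> prob {x \<in> space M. top_cluster B r (\<lambda>i. U E * c ^ i) \<kappa> (\<lambda>i. X i x)}"
      unfolding c0_def s_def .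
  qed
qed

text \<open>At the end of the block every value is at most \<open>u * c ^ Suc i\<close>, while
  \<open>r\<close> of them exceed \<open>u * c ^ i\<close>. The index \<open>b - 1\<close> appears
  because sums and maxima run over \<open>{..n}\<close>.\<close>

lemma psum_ge_of_top_cluster:
  assumes x: "\<And>l. 0 < X l x" and c: "1 < c" and u: "0 < u" and r: "1 \<le> r"
    and tc: "top_cluster {a..<b} r (\<lambda>i. u * c ^ i) \<kappa> (\<lambda>i. X i x)" and le: "\<And>l. l < a \<Longrightarrow> X l x \<le> u"
  shows "a < b" "real r * pmax (b - 1) x \<le> c * psum (b - 1) x"
proof -
  obtain i J where J': "J \<subseteq> {a..<b}" "card J = r"
    "\<forall>j\<in>{a..<b}. X j x \<in> (if j \<in> J then {u * c ^ i<..u * c ^ Suc i} else {..u * c ^ i})"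
    using tc unfolding top_cluster_def by blast
  note J = J'(1,2) J'(3)[rule_format]
  have "J \<noteq> {}" using J(2) r by auto
  then show ab: "a < b" using J(1) by auto
  have cp: "1 \<le> c ^ i" "c ^ i \<le> c ^ Suc i" using c by (auto simp: one_le_power)
  have "u \<le> u * c ^ i" "u * c ^ i \<le> u * c ^ Suc i"
    using u cp mult_left_mono[OF cp(1), of u] by (auto simp del: mult_le_cancel_left1)
  then have "X l x \<le> u * c ^ Suc i" if "l \<le> b - 1" for l
  proof -
    have "l < b" using that ab by linarith
    then show ?thesis
      using le[of l] J(3)[of l] \<open>u \<le> u * c ^ i\<close> \<open>u * c ^ i \<le> u * c ^ Suc i\<close>
      by (cases "l < a"; cases "l \<in> J") simp_all
  qed
  then have max: "pmax (b - 1) x \<le> u * c ^ Suc i" by (simp add: pmax_le_iff)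
  have "real r * (u * c ^ i) = (\<Sum>j\<in>J. u * c ^ i)" using J(2) by simp
  also have "\<dots> \<le> (\<Sum>j\<in>J. X j x)"
    using J(1,3) by (intro sum_mono) (force split: if_splits)
  also have "\<dots> \<le> psum (b - 1) x"
  proof -
    have "J \<subseteq> {..b - 1}"
    proof
      fix j assume "j \<in> J"
      then have "j < b" using J(1) by auto
      then show "j \<in> {..b - 1}" by simp
    qed
    then show ?thesis unfolding psum_def using x by (intro sum_mono2) (simp_all add: less_imp_le)
  qed
  finally have "c * (real r * (u * c ^ i)) \<le> c * psum (b - 1) x" using c by simp
  moreover have "real r * pmax (b - 1) x \<le> real r * (u * c ^ Suc i)" using max by (intro mult_left_mono) auto
  ultimately show "real r * pmax (b - 1) x \<le> c * psum (b - 1) x" by (simp add: mult_ac)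
qed

text \<open>In place of a zero-one law, the event \<open>?W\<close> is shown to have probability at
  least \<open>1 - \<eta>\<close> for every \<eta>; the blocks depend on \<eta>, the event does
  not.\<close>

lemma AE_frequently_psum_ge:
  assumes c: "1 < c" and r: "1 \<le> r" and div: "\<not> summable (\<lambda>n. g (U (exp (real n))) ^ (r - 1))"
  shows "AE x in M. \<exists>\<^sub>F i in sequentially. real r * pmax i x \<le> c * psum i x"
proof -
  let ?W = "{x \<in> space M. \<forall>N. \<exists>i\<ge>N. real r * pmax i x \<le> c * psum i x}"
  have W_meas [measurable]: "?W \<in> events" by measurable
  have lower: "1 - \<eta> \<le> prob ?W" if \<eta>: "0 < \<eta>" "\<eta> < 1" for \<eta>
  proof -
    \<comment> \<open>A block starting at \<open>\<eta> * exp n\<close> is preceded by so few draws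
      that one of them exceeds \<open>U (exp n)\<close> with probability at most \<eta>.\<close>
    define t where "t n = nat \<lfloor>\<eta> * exp (real n)\<rfloor>" for n :: nat
    define u where "u n = U (exp (real n))" for n :: nat
    have t_le: "real (t n) \<le> \<eta> * exp (real n)" for n
      using \<eta> by (simp add: t_def)
    have t_gt: "\<eta> * exp (real n) - 1 < real (t n)" for n
      using \<eta> unfolding t_def by linarith
    have t_mono: "mono t"
      unfolding t_def using \<eta> by (intro monoI nat_mono floor_mono mult_left_mono) auto
    have exp_lim: "filterlim (\<lambda>n. exp (real n)) at_top sequentially"
      by (intro filterlim_compose[OF exp_at_top] filterlim_real_sequentially)
    have u_lim: "filterlim u at_top sequentially"
      unfolding u_def by (rule filterlim_compose[OF rc_inv_at_top exp_lim])
    have \<eta>_lim: "filterlim (\<lambda>n. \<eta> * exp (real n)) at_top sequentially"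
      by (rule filterlim_tendsto_pos_mult_at_top[OF tendsto_const \<eta>(1) exp_lim])
    obtain x0 where x0: "0 < x0" "\<And>x. x0 \<le> x \<Longrightarrow> 0 < g x"
      "\<And>x y. x0 \<le> x \<Longrightarrow> x \<le> y \<Longrightarrow> g y \<le> g x"
      using g_decreasing by metis
    have "\<forall>\<^sub>F x in at_top. L (x * c) / L x < 5/4"
      using c by (intro order_tendstoD(2)[OF L_slow]) auto
    moreover have "\<forall>\<^sub>F x in at_top. k c / 2 < (L (x * c) / L x - 1) / g x"
      using c k_pos[OF c] by (intro order_tendstoD(1)[OF k_lim]) auto
    ultimately have "\<forall>\<^sub>F x in at_top. L (x * c) / L x < 5/4 \<and> k c / 2 < (L (x * c) / L x - 1) / g x"
      by eventually_elim auto
    then obtain x1 where x1: "\<And>x. x1 \<le> x \<Longrightarrow> L (x * c) / L x < 5/4"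
      "\<And>x. x1 \<le> x \<Longrightarrow> k c / 2 < (L (x * c) / L x - 1) / g x"
      by (auto simp: eventually_at_top_linorder)
    have "\<forall>\<^sub>F n in sequentially. max x0 x1 \<le> u n \<and> 2 * real r \<le> \<eta> * exp (real n)"
      using u_lim \<eta>_lim unfolding filterlim_at_top by (intro eventually_conj) blast+
    then obtain n1 where n1: "\<And>n. n1 \<le> n \<Longrightarrow> max x0 x1 \<le> u n \<and> 2 * real r \<le> \<eta> * exp (real n)"
      by (auto simp: eventually_sequentially)
    define \<beta> where "\<beta> = (\<eta> / (2 * real r)) ^ r * (k c / (2 * exp 1)) ^ (r - 1) * exp (- (2 * exp 1)) / 2"
    have \<beta>: "0 < \<beta>" using \<eta> r k_pos[OF c] by (simp add: \<beta>_def)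
    have "\<exists>\<kappa>. n1 \<le> n \<longrightarrow> \<beta> * g (U (exp (real (Suc n)))) ^ (r - 1)
      \<le> prob {x \<in> space M. top_cluster {t n..<t (Suc n)} r (\<lambda>i. u n * c ^ i) \<kappa> (\<lambda>i. X i x)}" for n
    proof (cases "n1 \<le> n")
      case True
      let ?E = "exp (real n)"
      have un: "x0 \<le> U ?E" "x1 \<le> U ?E" "2 * real r \<le> \<eta> * ?E"
        using n1[OF True] by (auto simp: u_def)
      have card: "real (card {t n..<t (Suc n)}) = real (t (Suc n)) - real (t n)"
        using monoD[OF t_mono, of n "Suc n"] by simp
      have e2: "2 \<le> exp (1::real)" using exp_ge_add_one_self[of 1] by simp
      have eE: "\<eta> * exp (real (Suc n)) = exp 1 * (\<eta> * ?E)" by (simp add: exp_add)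
      have eE2: "2 * (\<eta> * ?E) \<le> exp 1 * (\<eta> * ?E)"
        using e2 \<eta> by (intro mult_right_mono) auto
      obtain \<kappa> where "(\<eta> / (2 * real r)) ^ r * (k c / (2 * exp 1)) ^ (r - 1) * exp (- (2 * exp 1)) / 2
          * g (U (exp (real (Suc n)))) ^ (r - 1)
        \<le> prob {x \<in> space M. top_cluster {t n..<t (Suc n)} r (\<lambda>i. U ?E * c ^ i) \<kappa> (\<lambda>i. X i x)}"
      proof (rule scale_cluster_bound[OF c r, where \<eta> = \<eta> and n = n and B = "{t n..<t (Suc n)}"])
        show "0 < U ?E" using un x0 by linarith
        show "g y \<le> g x" if "U ?E \<le> x" "x \<le> y" for x y using that un x0 by (intro x0(3)) auto
        show "0 \<le> g (U (exp (real (Suc n))))"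
        proof -
          have "U ?E \<le> U (exp (real (Suc n)))" by (rule rc_inv_mono) auto
          then show ?thesis using x0(2)[OF order_trans[OF un(1)]] by (simp add: less_imp_le)
        qed
        show "L (x * c) / L x < 5/4" if "U ?E \<le> x" for x using that un by (intro x1(1)) auto
        show "k c / 2 * g x \<le> L (x * c) / L x - 1" if "U ?E \<le> x" for x
          using x1(2)[of x] x0(2)[of x] that un by (simp add: less_divide_eq)
        \<comment> \<open>As \<open>exp 1 \<ge> 2\<close>, the block has more than
          \<open>\<eta> * ?E - 1\<close> elements, and the 1 lost to rounding is at most half of
          \<open>\<eta> * ?E\<close>.\<close>
        show "\<eta> * ?E / 2 \<le> real (card {t n..<t (Suc n)})"
          using card t_le[of n] t_gt[of "Suc n"] eE eE2 un(3) r by linarith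
        have "\<eta> * exp (real (Suc n)) \<le> 1 * exp (real (Suc n))"
          using \<eta> by (intro mult_right_mono) auto
        then have "real (card {t n..<t (Suc n)}) \<le> exp (real (Suc n))"
          unfolding card using t_le[of "Suc n"] by linarith
        then show "real (card {t n..<t (Suc n)}) \<le> exp 1 * ?E"
          using card t_le[of "Suc n"] exp_add[of 1 "real n"] by simp
      qed (use \<eta> un in auto)
      then show ?thesis unfolding \<beta>_def u_def by blast
    qed auto
    then obtain \<kappa> where \<kappa>: "\<And>n. n1 \<le> n \<Longrightarrow> \<beta> * g (U (exp (real (Suc n)))) ^ (r - 1)
      \<le> prob {x \<in> space M. top_cluster {t n..<t (Suc n)} r (\<lambda>i. u n * c ^ i) (\<kappa> n) (\<lambda>i. X i x)}"
      by metis
    let ?V = "{x \<in> space M. \<exists>\<^sub>F n in sequentially. (\<forall>l<t n. X l x \<le> u n) \<and>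
      top_cluster {t n..<t (Suc n)} r (\<lambda>i. u n * c ^ i) (\<kappa> n) (\<lambda>i. X i x)}"
    have "1 - \<eta> \<le> prob ?V"
    proof (rule frequently_top_cluster[OF t_mono])
      show "0 \<le> 1 - \<eta>" using \<eta> by simp
      show "1 - \<eta> \<le> prob {x \<in> space M. \<forall>l<t n. X l x \<le> u n}" if "0 \<le> n" for n
      proof -
        have "prob {x \<in> space M. \<exists>l\<in>{..<t n}. U (exp (real n)) < X l x} \<le> real (card {..<t n}) / exp (real n)"
          by (rule prob_ex_gt) auto
        also have "\<dots> \<le> \<eta>" using t_le[of n] by (simp add: field_simps)
        finally have "1 - \<eta> \<le> 1 - prob {x \<in> space M. \<exists>l\<in>{..<t n}. U (exp (real n)) < X l x}" by simp
        also have "\<dots> = prob {x \<in> space M. \<not> (\<exists>l\<in>{..<t n}. U (exp (real n)) < X l x)}"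
          by (rule prob_neg[symmetric]) measurable
        finally show ?thesis by (simp add: u_def not_less Ball_def)
      qed
      show "\<not> summable (\<lambda>n. prob {x \<in> space M. top_cluster {t n..<t (Suc n)} r (\<lambda>i. u n * c ^ i) (\<kappa> n) (\<lambda>i. X i x)})"
      proof
        assume "summable (\<lambda>n. prob {x \<in> space M. top_cluster {t n..<t (Suc n)} r (\<lambda>i. u n * c ^ i) (\<kappa> n) (\<lambda>i. X i x)})"
        then have "summable (\<lambda>n. \<beta> * g (U (exp (real (Suc n)))) ^ (r - 1))"
        proof (rule summable_comparison_test'[where N = n1])
          fix n assume n: "n1 \<le> n"
          have "0 < g (U (exp (real (Suc n))))"
            using n1[of "Suc n"] n by (intro x0(2)) (auto simp: u_def)
          then show "norm (\<beta> * g (U (exp (real (Suc n)))) ^ (r - 1))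
            \<le> prob {x \<in> space M. top_cluster {t n..<t (Suc n)} r (\<lambda>i. u n * c ^ i) (\<kappa> n) (\<lambda>i. X i x)}"
            using \<kappa>[OF n] \<beta> by (simp add: abs_mult)
        qed
        then have "summable (\<lambda>n. (1 / \<beta>) * (\<beta> * g (U (exp (real (Suc n)))) ^ (r - 1)))"
          by (rule summable_mult)
        then have "summable (\<lambda>n. g (U (exp (real (Suc n)))) ^ (r - 1))" using \<beta> by simp
        then show False
          using div summable_Suc_iff[of "\<lambda>n. g (U (exp (real n))) ^ (r - 1)"] by simp
      qed
    qed
    also have "prob ?V \<le> prob ?W"
    proof (rule finite_measure_mono_AE[OF _ W_meas])
      show "AE x in M. x \<in> ?V \<longrightarrow> x \<in> ?W"
        using AE_pos
      proof eventually_elim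
        case (elim x)
        show ?case
        proof
          assume x: "x \<in> ?V"
          have "\<exists>i\<ge>N. real r * pmax i x \<le> c * psum i x" for N
          proof -
            have "\<forall>\<^sub>F n in sequentially. real N + 1 \<le> \<eta> * exp (real n)"
              using \<eta>_lim unfolding filterlim_at_top by blast
            then have ev: "\<forall>\<^sub>F n in sequentially. real N + 1 \<le> \<eta> * exp (real n) \<and> n1 \<le> n"
              using eventually_ge_at_top[of n1] by eventually_elim auto
            have "\<exists>\<^sub>F n in sequentially. (\<forall>l<t n. X l x \<le> u n) \<and>
                top_cluster {t n..<t (Suc n)} r (\<lambda>i. u n * c ^ i) (\<kappa> n) (\<lambda>i. X i x)"
              using x by simp
            from frequently_eventually_frequently[OF this ev]
            obtain n where n: "\<forall>l<t n. X l x \<le> u n"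
              "top_cluster {t n..<t (Suc n)} r (\<lambda>i. u n * c ^ i) (\<kappa> n) (\<lambda>i. X i x)"
              "real N + 1 \<le> \<eta> * exp (real n)" "n1 \<le> n"
              by (auto dest: frequently_ex)
            have un: "0 < u n" using n1[OF n(4)] x0 by linarith
            have *: "t n < t (Suc n)" "real r * pmax (t (Suc n) - 1) x \<le> c * psum (t (Suc n) - 1) x"
              using psum_ge_of_top_cluster[OF _ c un r n(2)] elim n(1) by auto
            have "N \<le> t n" using t_gt[of n] n(3) by linarith
            then have "N \<le> t (Suc n) - 1" using *(1) by linarith
            with *(2) show ?thesis by blast
          qed
          then show "x \<in> ?W" using x by blast
        qed
      qed
    qed
    finally show ?thesis .
  qed
  have "1 \<le> prob ?W"
  proof (rule field_le_epsilon)
    fix e :: real assume "0 < e"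
    then show "1 \<le> prob ?W + e"
      using lower[of e] measure_nonneg[of M ?W] by (cases "e < 1") linarith+
  qed
  then have "prob ?W = 1" using prob_le_1[of ?W] by linarith
  then have "AE x in M. x \<in> ?W" by (simp add: prob_eq_1 del: mem_Collect_eq)
  then show ?thesis
    by (rule AE_mp) (auto simp: frequently_sequentially)
qed

section \<open>Passage to lower and upper limits along countably many tolerances\<close>

lemma dfun_eq: "dfun L g y = g (U y)"
  by (simp add: dfun_def)

lemma AE_liminf_eq_1:
  "AE x in M. liminf (\<lambda>i. ereal (psum i x / pmax i x)) = 1"
proof -
  have "AE x in M. \<forall>m. \<exists>\<^sub>F n in sequentially. psum n x \<le> (1 + 1 / real (Suc m)) * pmax n x"
    unfolding AE_all_countable by (intro allI AE_frequently_psum_le) simp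
  then show ?thesis
    using AE_pos
  proof eventually_elim
    case (elim x)
    have mp: "0 < pmax i x" for i using elim(2) by (intro pmax_pos) auto
    show ?case
    proof (rule antisym)
      show "liminf (\<lambda>i. ereal (psum i x / pmax i x)) \<le> 1"
      proof (rule dense_ge)
        fix z :: ereal assume z: "1 < z"
        obtain w where w: "1 < ereal w" "ereal w < z" using ereal_dense2[OF z] by auto
        then have "0 < w - 1" by simp
        then obtain m where m: "1 / real (Suc m) < w - 1"
          using reals_Archimedean[of "w - 1"] by (auto simp: inverse_eq_divide)
        show "liminf (\<lambda>i. ereal (psum i x / pmax i x)) \<le> z"
        proof (rule ccontr)
          assume "\<not> ?thesis"
          then have "ereal w < liminf (\<lambda>i. ereal (psum i x / pmax i x))" using w(2) by simp
          then have "\<forall>\<^sub>F i in sequentially. w < psum i x / pmax i x"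
            by (auto dest: less_LiminfD)
          with elim(1) have "\<exists>\<^sub>F n in sequentially. psum n x \<le> (1 + 1 / real (Suc m)) * pmax n x
              \<and> w < psum n x / pmax n x"
            by (intro frequently_eventually_frequently) auto
          then obtain n where n: "psum n x \<le> (1 + 1 / real (Suc m)) * pmax n x" "w < psum n x / pmax n x"
            by (auto dest: frequently_ex)
          have "psum n x / pmax n x \<le> 1 + 1 / real (Suc m)"
            using n(1) mp[of n] by (simp add: divide_le_eq)
          then show False using n(2) m by linarith
        qed
      qed
      show "1 \<le> liminf (\<lambda>i. ereal (psum i x / pmax i x))"
      proof (intro Liminf_bounded always_eventually allI)
        fix i
        have "pmax i x \<le> psum i x" using elim(2) by (intro pmax_le_psum) auto
        then show "1 \<le> ereal (psum i x / pmax i x)" using mp[of i] by (simp add: le_divide_eq)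
      qed
    qed
  qed
qed

lemma AE_limsup_le:
  assumes r: "1 \<le> r" and sm: "summable (\<lambda>n. (g (U (exp (real n))) * ln (real n)) ^ r)"
  shows "AE x in M. limsup (\<lambda>i. ereal (psum i x / pmax i x)) \<le> ereal (real r)"
proof -
  have "AE x in M. \<forall>m. \<forall>\<^sub>F n in sequentially. psum n x \<le> (real r + real r * (1 / real (Suc m))) * pmax n x"
    unfolding AE_all_countable by (intro allI AE_eventually_psum_le r sm) simp
  then show ?thesis
    using AE_pos
  proof eventually_elim
    case (elim x)
    have mp: "0 < pmax i x" for i using elim(2) by (intro pmax_pos) auto
    have bd: "limsup (\<lambda>i. ereal (psum i x / pmax i x)) \<le> ereal (real r + real r * (1 / real (Suc m)))" for m
    proof (rule Limsup_bounded)
      show "\<forall>\<^sub>F i in sequentially. ereal (psum i x / pmax i x) \<le> ereal (real r + real r * (1 / real (Suc m)))"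
        using elim(1)[rule_format, of m]
        by eventually_elim (use mp in \<open>simp add: divide_le_eq\<close>)
    qed
    have "(\<lambda>m. real r + real r * (1 / real (Suc m))) \<longlonglongrightarrow> real r + real r * 0"
      using LIMSEQ_inverse_real_of_nat by (intro tendsto_intros) (simp add: inverse_eq_divide)
    then have "(\<lambda>m. ereal (real r + real r * (1 / real (Suc m)))) \<longlonglongrightarrow> ereal (real r)"
      by (simp add: tendsto_ereal)
    then show ?case
      by (rule LIMSEQ_le_const) (use bd in auto)
  qed
qed

lemma AE_limsup_ge:
  assumes r: "1 \<le> r" and div: "\<not> summable (\<lambda>n. g (U (exp (real n))) ^ (r - 1))"
  shows "AE x in M. ereal (real r) \<le> limsup (\<lambda>i. ereal (psum i x / pmax i x))"
proof -
  have "AE x in M. \<forall>m. \<exists>\<^sub>F i in sequentially. real r * pmax i x \<le> (1 + 1 / real (Suc m)) * psum i x"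
    unfolding AE_all_countable by (intro allI AE_frequently_psum_ge r div) simp
  then show ?thesis
    using AE_pos
  proof eventually_elim
    case (elim x)
    have mp: "0 < pmax i x" for i using elim(2) by (intro pmax_pos) auto
    have bd: "ereal (real r / (1 + 1 / real (Suc m))) \<le> limsup (\<lambda>i. ereal (psum i x / pmax i x))" for m
    proof (rule ccontr)
      assume "\<not> ?thesis"
      then have "\<forall>\<^sub>F i in sequentially. psum i x / pmax i x < real r / (1 + 1 / real (Suc m))"
        by (auto simp: not_le dest: Limsup_lessD)
      with elim(1) have "\<exists>\<^sub>F i in sequentially. real r * pmax i x \<le> (1 + 1 / real (Suc m)) * psum i x
          \<and> psum i x / pmax i x < real r / (1 + 1 / real (Suc m))"
        by (intro frequently_eventually_frequently) auto
      then obtain i where i: "real r * pmax i x \<le> (1 + 1 / real (Suc m)) * psum i x"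
        "psum i x / pmax i x < real r / (1 + 1 / real (Suc m))"
        by (auto dest: frequently_ex)
      have "0 < 1 + 1 / real (Suc m)" by (simp add: add_pos_pos)
      with i mp[of i] show False
        by (simp add: divide_less_eq less_divide_eq mult_ac del: of_nat_Suc)
    qed
    have "(\<lambda>m. real r / (1 + 1 / real (Suc m))) \<longlonglongrightarrow> real r / (1 + 0)"
      using LIMSEQ_inverse_real_of_nat by (intro tendsto_intros) (auto simp: inverse_eq_divide)
    then have "(\<lambda>m. ereal (real r / (1 + 1 / real (Suc m)))) \<longlonglongrightarrow> ereal (real r)"
      by (simp add: tendsto_ereal)
    then show ?case
      by (rule LIMSEQ_le_const2) (use bd in auto)
  qed
qed

lemma N_index_finite:
  assumes "N_index (dfun L g) = enat l"
  shows "2 \<le> l" "summable (\<lambda>n. (g (U (exp (real n))) * ln (real n)) ^ (l - 1))"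
proof -
  let ?P = "\<lambda>l::nat. 2 \<le> l \<and> summable (\<lambda>n::nat. (dfun L g (exp (real n)) * ln (real n)) ^ (l - 1))"
  have ex: "\<exists>l. ?P l" and l: "l = (LEAST l. ?P l)"
    using assms unfolding N_index_def by (auto split: if_splits)
  have "?P l" unfolding l using ex by (rule LeastI_ex)
  then show "2 \<le> l" "summable (\<lambda>n. (g (U (exp (real n))) * ln (real n)) ^ (l - 1))"
    by (simp_all add: dfun_eq)
qed

end

section \<open>Analytic properties of the reciprocal tail\<close>

context iid_sequence
begin

lemma tail_antimono: "u \<le> v \<Longrightarrow> prob {x \<in> space M. v < X 0 x} \<le> prob {x \<in> space M. u < X 0 x}"
  by (intro finite_measure_mono) auto

lemma tailL_0: "L 0 = 1"
proof -
  have "prob {x \<in> space M. 0 < X 0 x} = 1"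
    using pos by (subst prob_Collect_eq_1) auto
  then show ?thesis by (simp add: tailL_def)
qed

text \<open>If the tail vanished, \<^term>\<open>L\<close> would jump from values \<open>\<ge> 1\<close> to the value \<open>1 / 0 = 0\<close>.\<close>
lemma tail_pos:
  assumes cont: "continuous_on UNIV L"
  shows "0 < prob {x \<in> space M. u < X 0 x}"
proof (rule ccontr)
  assume "\<not> ?thesis"
  then have z: "prob {x \<in> space M. u < X 0 x} = 0" by (simp add: not_less measure_le_0_iff)
  have "0 \<le> u"
    using tail_antimono[of u 0] tailL_0 z by (cases "0 \<le> u") (auto simp: tailL_def)
  moreover have "L u \<le> 1/2" "1/2 \<le> L 0" using tailL_0 z by (auto simp: tailL_def)
  ultimately obtain x where "L x = 1/2"
    using IVT2'[of L u "1/2" 0] continuous_on_subset[OF cont, of "{0..u}"] by auto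
  then have "prob {y \<in> space M. x < X 0 y} = 1 / (1/2)"
    by (simp only: prob_gt)
  then show False using prob_le_1[of "{y \<in> space M. x < X 0 y}"] by simp
qed

lemma tailL_mono:
  assumes "continuous_on UNIV L"
  shows "mono L"
  unfolding tailL_def using tail_pos[OF assms] tail_antimono
  by (intro monoI divide_left_mono mult_pos_pos) auto

lemma tailL_at_top:
  assumes "continuous_on UNIV L"
  shows "filterlim L at_top at_top"
proof -
  interpret D: real_distribution "distr M borel (X 0)"
    by (rule real_distribution_distr) simp
  have cdf: "cdf (distr M borel (X 0)) u = 1 - 1 / L u" for u
  proof -
    have "X 0 -` {..u} \<inter> space M = {x \<in> space M. X 0 x \<le> u}" by auto
    then show ?thesis by (simp add: cdf_def measure_distr prob_le)
  qed
  have "((\<lambda>u. 1 - cdf (distr M borel (X 0)) u) \<longlongrightarrow> 1 - 1) at_top"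
    by (intro tendsto_diff tendsto_const D.cdf_lim_at_top_prob)
  then have "((\<lambda>u. prob {x \<in> space M. u < X 0 x}) \<longlongrightarrow> 0) at_top"
    by (simp add: cdf prob_gt)
  then have "filterlim (\<lambda>u. inverse (prob {x \<in> space M. u < X 0 x})) at_top at_top"
    by (rule filterlim_inverse_at_top) (use tail_pos[OF assms] in auto)
  then show ?thesis
    by (simp add: tailL_def[abs_def] inverse_eq_divide)
qed

end

theorem theorem1p5:
  fixes M :: "'a measure" and \<sigma> :: "nat \<Rightarrow> 'a \<Rightarrow> real"
    and g k :: "real \<Rightarrow> real"
  assumes prob: "prob_space M"
    and rv: "\<And>i. \<sigma> i \<in> borel_measurable M"
    and indep: "prob_space.indep_vars M (\<lambda>_. borel) \<sigma> UNIV"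
    and ident: "\<And>i. distr M borel (\<sigma> i) = distr M borel (\<sigma> 0)"
    and pos: "AE x in M. 0 < \<sigma> 0 x"
    and slow: "\<And>v. 0 < v \<Longrightarrow>
       ((\<lambda>u. tailL M (\<sigma> 0) (u * v) / tailL M (\<sigma> 0) u) \<longlongrightarrow> 1) at_top"
    and L_cont: "continuous_on UNIV (tailL M (\<sigma> 0))"
    and g_lim: "(g \<longlongrightarrow> 0) at_top"
    and g_mono: "\<exists>u0. \<forall>x y. u0 \<le> x \<longrightarrow> x \<le> y \<longrightarrow> g y \<le> g x"
    and k_lim: "\<And>v. 0 < v \<Longrightarrow>
       ((\<lambda>u. (tailL M (\<sigma> 0) (u * v) / tailL M (\<sigma> 0) u - 1) / g u) \<longlongrightarrow> k v) at_top"
    and k_nontriv: "\<exists>v>0. k v \<noteq> 0 \<and> (\<forall>u>0. k (u * v) \<noteq> k u)"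
  shows "(AE x in M.
            liminf (\<lambda>i. ereal ((\<Sum>j\<le>i. \<sigma> j x) / Max ((\<lambda>j. \<sigma> j x) ` {..i}))) = 1 \<and>
            limsup (\<lambda>i. ereal ((\<Sum>j\<le>i. \<sigma> j x) / Max ((\<lambda>j. \<sigma> j x) ` {..i})))
              \<le> ereal_of_enat (N_index (dfun (tailL M (\<sigma> 0)) g)) - 1)
       \<and> (\<forall>l::nat. N_index (dfun (tailL M (\<sigma> 0)) g) = enat l \<longrightarrow>
            \<not> summable (\<lambda>n::nat. dfun (tailL M (\<sigma> 0)) g (exp (real n)) ^ (l - 2)) \<longrightarrow>
            (AE x in M. limsup (\<lambda>i. ereal ((\<Sum>j\<le>i. \<sigma> j x) / Max ((\<lambda>j. \<sigma> j x) ` {..i})))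
               = ereal (real l) - 1))"
proof -
  interpret iid: iid_sequence M \<sigma>
    using prob rv indep ident pos by (simp add: iid_sequence_def iid_sequence_axioms_def)
  interpret iid_slow M \<sigma> g k
  proof unfold_locales
    show "mono (tailL M (\<sigma> 0))" by (rule iid.tailL_mono[OF L_cont])
    show "tailL M (\<sigma> 0) 0 = 1" by (rule iid.tailL_0)
    show "filterlim (tailL M (\<sigma> 0)) at_top at_top" by (rule iid.tailL_at_top[OF L_cont])
  qed (use L_cont slow g_lim g_mono k_lim k_nontriv in blast)+
  have minus_one: "ereal (real l) - 1 = ereal (real (l - 1))" if "2 \<le> l" for l
    using that by (simp add: one_ereal_def)
  show ?thesis
    unfolding psum_def[symmetric] pmax_def[symmetric]
  proof (intro conjI allI impI)
    have "AE x in M. limsup (\<lambda>i. ereal (psum i x / pmax i x))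
      \<le> ereal_of_enat (N_index (dfun (tailL M (\<sigma> 0)) g)) - 1"
    \<comment> \<open>For an infinite index the bound is infinite and therefore trivial.\<close>
    proof (cases "N_index (dfun (tailL M (\<sigma> 0)) g)")
      case (enat l)
      show ?thesis
        using AE_limsup_le[of "l - 1"] N_index_finite[OF enat] minus_one[of l] enat by simp
    qed simp
    then show "AE x in M. liminf (\<lambda>i. ereal (psum i x / pmax i x)) = 1 \<and>
        limsup (\<lambda>i. ereal (psum i x / pmax i x)) \<le> ereal_of_enat (N_index (dfun (tailL M (\<sigma> 0)) g)) - 1"
      using AE_liminf_eq_1 by eventually_elim auto
  next
    fix l
    assume l: "N_index (dfun (tailL M (\<sigma> 0)) g) = enat l"
      and div: "\<not> summable (\<lambda>n. dfun (tailL M (\<sigma> 0)) g (exp (real n)) ^ (l - 2))"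
    \<comment> \<open>The lower bound is applied with \<open>r = l - 1\<close>, whose divergence
      condition has exponent \<open>r - 1\<close>.\<close>
    have "l - 1 - 1 = l - 2" by simp
    then have "AE x in M. ereal (real (l - 1)) \<le> limsup (\<lambda>i. ereal (psum i x / pmax i x))"
      using N_index_finite(1)[OF l] div by (intro AE_limsup_ge) (simp_all only: dfun_eq, simp)
    moreover have "AE x in M. limsup (\<lambda>i. ereal (psum i x / pmax i x)) \<le> ereal (real (l - 1))"
      using N_index_finite[OF l] by (intro AE_limsup_le) auto
    ultimately show "AE x in M. limsup (\<lambda>i. ereal (psum i x / pmax i x)) = ereal (real l) - 1"
      unfolding minus_one[OF N_index_finite(1)[OF l]] by eventually_elim (rule antisym)
  qed
qed

end
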